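(* Let $\Phi$ be a locally square-integrable invariant random measure on $\mathbb R^d$, and let $K,L$ be invariant probability kernels from $\Omega\times\mathbb R^d$ to $\mathbb R^d$. Let $W\in\mathcal K_0$. Define $\kappa\colon\mathbb R^d\to[0,2]$ by $$\kappa(y):=\big\|\mathbb E^\Phi_{0,y}[K_y\otimes K_0-L_y\otimes L_0]\big\|,\quad y\in\mathbb R^d,$$ and assume that $\int\kappa(y)\,\alpha_\Phi(\mathrm dy)<\infty$. Then $$\lim_{r\to\infty}\lambda_d(rW)^{-1}\operatorname{Var}[K\Phi(rW)]=\lim_{r\to\infty}\lambda_d(rW)^{-1}\operatorname{Var}[L\Phi(rW)]$$ if one of the limits exists. In particular, $K\Phi$ is hyperuniform with respect to $W$ if and only if $L\Phi$ is hyperuniform with respect to $W$.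
   Context: $\lambda_d$ is Lebesgue measure and $\mathcal B^d$ the Borel $\sigma$-field on $\mathbb R^d$. $(\Omega,\mathcal A,\mathbb P)$ is a probability space, $(\Omega,\mathcal A)$ is a Borel space, and there is a measurable flow on $\Omega$: maps $\theta_x\colon\Omega\to\Omega$, $x\in\mathbb R^d$, with $(\omega,x)\mapsto\theta_x\omega$ measurable, $\theta_0=\mathrm{id}$, $\theta_x\circ\theta_y=\theta_{x+y}$, and $\mathbb P(\theta_xA)=\mathbb P(A)$ for all $x\in\mathbb R^d$, $A\in\mathcal A$. A random measure $\Phi$ on $\mathbb R^d$ is a random locally finite measure. It is invariant if $\Phi(\omega,B+x)=\Phi(\theta_x\omega,B)$ for all $\omega,x,B$, and locally square-integrable if $\mathbb E\Phi(B)^2<\infty$ for all bounded $B\in\mathcal B^d$. Its intensity $\gamma:=\mathbb E\Phi([0,1]^d)$ is assumed positive and finite. The reduced second moment measure is $$\alpha_\Phi(B):=\mathbb E\int \mathbf 1\{x\in[0,1]^d,\,y-x\in B\}\,\Phi^2(\mathrm d(x,y)),\quad B\in\mathcal B^d .$$ For locally square-integrable $\Phi$, the two-point Palm probability measures $\mathbb P^\Phi_{0,y}$, $y\in\mathbb R^d$, form a probability kernel from $\mathbb R^d$ to $\Omega$ satisfying $$\mathbb E\int f(x,y-x,\theta_x)\,\Phi^2(\mathrm d(x,y))=\iiint f(x,y,\omega)\,\mathbb P^\Phi_{0,y}(\mathrm d\omega)\,\alpha_\Phi(\mathrm dy)\,\mathrm dx$$ for all measurable $f\colon\mathbb R^d\times\mathbb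 R^d\times\Omega\to[0,\infty]$; $\mathbb E^\Phi_{0,y}$ is the corresponding expectation. A probability kernel $K$ from $\Omega\times\mathbb R^d$ to $\mathbb R^d$ is invariant if $K(\omega,x,B+x)=K(\theta_x\omega,0,B)$ for all $\omega,x,B$. Write $K_x=K(x)$ for the random probability measure $\omega\mapsto K(\omega,x,\cdot)$ and $K\Phi(\omega,\cdot):=\int K(\omega,x,\cdot)\,\Phi(\omega,\mathrm dx)$ (an invariant random measure with the same intensity as $\Phi$, a.s. locally finite). The expectation of a random (signed) measure is the measure obtained by taking expectations setwise. For a finite signed measure $\nu$, $\|\nu\|:=\sup|\int f\,\mathrm d\nu|$ over measurable $f$ with values in $[-1,1]$. $\mathcal K_0$ is the set of convex bounded sets containing $0$ in their interior. A stationary locally square-integrable random measure $\Psi$ is hyperuniform w.r.t. $W$ if $\lim_{r\to\infty}\lambda_d(rW)^{-1}\operatorname{Var}[\Psi(rW)]=0$. The limits are regarded as well-defined only for locally square-integrable random measures. *)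

theory Defs
  imports "HOL-Probability.Probability"
begin

definition translate :: "'a::euclidean_space \<Rightarrow> 'a set \<Rightarrow> 'a set" where
  "translate x B = (\<lambda>b. b + x) ` B"

definition scale :: "real \<Rightarrow> 'a::euclidean_space set \<Rightarrow> 'a set" where
  "scale r W = (\<lambda>w. r *\<^sub>R w) ` W"

definition borel_space :: "'w measure \<Rightarrow> bool" where
  "borel_space M \<longleftrightarrow>
     (\<exists>S \<in> sets (borel :: real measure). S \<subseteq> {0..1} \<and>
        (\<exists>f g. f \<in> M \<rightarrow>\<^sub>M restrict_space borel S \<and> g \<in> restrict_space borel S \<rightarrow>\<^sub>M M \<and>
           (\<forall>\<omega>\<in>space M. g (f \<omega>) = \<omega>) \<and> (\<forall>s\<in>S. f (g s) = s)))"

text \<open>Flows, random measures and kernels are constrained only on \<open>space M\<close>; the joint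
  measurability of a flow implies that each \<open>\<theta> x\<close> maps \<open>space M\<close> into itself.\<close>

definition stationary_flow :: "'w measure \<Rightarrow> ('a::euclidean_space \<Rightarrow> 'w \<Rightarrow> 'w) \<Rightarrow> bool" where
  "stationary_flow M \<theta> \<longleftrightarrow>
     (\<lambda>(\<omega>, x). \<theta> x \<omega>) \<in> M \<Otimes>\<^sub>M borel \<rightarrow>\<^sub>M M \<and>
     (\<forall>\<omega>\<in>space M. \<theta> 0 \<omega> = \<omega>) \<and>
     (\<forall>x y. \<forall>\<omega>\<in>space M. \<theta> x (\<theta> y \<omega>) = \<theta> (x + y) \<omega>) \<and>
     (\<forall>x. \<forall>A\<in>sets M. emeasure M (\<theta> x ` A) = emeasure M A)"

definition random_measure :: "'w measure \<Rightarrow> ('w \<Rightarrow> 'a::euclidean_space measure) \<Rightarrow> bool" where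
  "random_measure M \<Phi> \<longleftrightarrow>
     (\<forall>\<omega>\<in>space M. sets (\<Phi> \<omega>) = sets borel) \<and>
     (\<forall>\<omega>\<in>space M. \<forall>B\<in>sets borel. bounded B \<longrightarrow> emeasure (\<Phi> \<omega>) B < \<infinity>) \<and>
     (\<forall>B\<in>sets borel. (\<lambda>\<omega>. emeasure (\<Phi> \<omega>) B) \<in> borel_measurable M)"

definition invariant_measure ::
  "'w measure \<Rightarrow> ('a::euclidean_space \<Rightarrow> 'w \<Rightarrow> 'w) \<Rightarrow> ('w \<Rightarrow> 'a measure) \<Rightarrow> bool" where
  "invariant_measure M \<theta> \<Phi> \<longleftrightarrow>
     (\<forall>\<omega>\<in>space M. \<forall>x. \<forall>B\<in>sets borel.
        emeasure (\<Phi> \<omega>) (translate x B) = emeasure (\<Phi> (\<theta> x \<omega>)) B)"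

definition locally_square_integrable ::
  "'w measure \<Rightarrow> ('w \<Rightarrow> 'a::euclidean_space measure) \<Rightarrow> bool" where
  "locally_square_integrable M \<Psi> \<longleftrightarrow>
     (\<forall>B\<in>sets borel. bounded B \<longrightarrow> (\<integral>\<^sup>+\<omega>. (emeasure (\<Psi> \<omega>) B)\<^sup>2 \<partial>M) < \<infinity>)"

definition intensity :: "'w measure \<Rightarrow> ('w \<Rightarrow> 'a::euclidean_space measure) \<Rightarrow> ennreal" where
  "intensity M \<Phi> = (\<integral>\<^sup>+\<omega>. emeasure (\<Phi> \<omega>) (cbox 0 One) \<partial>M)"

definition reduced_second_moment ::
  "'w measure \<Rightarrow> ('w \<Rightarrow> 'a::euclidean_space measure) \<Rightarrow> 'a measure" where
  "reduced_second_moment M \<Phi> = measure_of UNIV (sets borel)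
     (\<lambda>B. \<integral>\<^sup>+\<omega>. (\<integral>\<^sup>+(x, y). indicator (cbox 0 One) x * indicator B (y - x)
                 \<partial>(\<Phi> \<omega> \<Otimes>\<^sub>M \<Phi> \<omega>)) \<partial>M)"

text \<open>\<open>Q y\<close> plays the role of the two-point Palm measure at \<open>(0, y)\<close>.  The disintegration
  determines \<open>Q\<close> only up to a null set of \<open>reduced_second_moment M \<Phi>\<close>, so this is a
  predicate on versions.\<close>

definition two_point_palm ::
  "'w measure \<Rightarrow> ('a::euclidean_space \<Rightarrow> 'w \<Rightarrow> 'w) \<Rightarrow> ('w \<Rightarrow> 'a measure) \<Rightarrow>
     ('a \<Rightarrow> 'w measure) \<Rightarrow> bool" where
  "two_point_palm M \<theta> \<Phi> Q \<longleftrightarrow>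
     Q \<in> borel \<rightarrow>\<^sub>M prob_algebra M \<and>
     (\<forall>f \<in> borel_measurable (borel \<Otimes>\<^sub>M borel \<Otimes>\<^sub>M M) :: ('a \<times> 'a \<times> 'w \<Rightarrow> ennreal) set.
        (\<integral>\<^sup>+\<omega>. (\<integral>\<^sup>+(x, y). f (x, y - x, \<theta> x \<omega>) \<partial>(\<Phi> \<omega> \<Otimes>\<^sub>M \<Phi> \<omega>)) \<partial>M) =
        (\<integral>\<^sup>+x. (\<integral>\<^sup>+y. (\<integral>\<^sup>+\<omega>. f (x, y, \<omega>) \<partial>Q y) \<partial>reduced_second_moment M \<Phi>) \<partial>lborel))"

definition invariant_prob_kernel ::
  "'w measure \<Rightarrow> ('a::euclidean_space \<Rightarrow> 'w \<Rightarrow> 'w) \<Rightarrow> ('w \<Rightarrow> 'a \<Rightarrow> 'a measure) \<Rightarrow> bool" where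
  "invariant_prob_kernel M \<theta> K \<longleftrightarrow>
     (\<lambda>(\<omega>, x). K \<omega> x) \<in> M \<Otimes>\<^sub>M borel \<rightarrow>\<^sub>M prob_algebra borel \<and>
     (\<forall>\<omega>\<in>space M. \<forall>x. \<forall>B\<in>sets borel.
        emeasure (K \<omega> x) (translate x B) = emeasure (K (\<theta> x \<omega>) 0) B)"

text \<open>The random measure $K\Phi$.  By \<open>emeasure_bind\<close>, which needs no finiteness of
  \<open>\<Phi> \<omega>\<close>, its value on a Borel set \<open>B\<close> is \<open>\<integral>\<^sup>+x. emeasure (K \<omega> x) B \<partial>\<Phi> \<omega>\<close>.\<close>

definition transport ::
  "('w \<Rightarrow> 'a::euclidean_space \<Rightarrow> 'a measure) \<Rightarrow> ('w \<Rightarrow> 'a measure) \<Rightarrow> 'w \<Rightarrow> 'a measure" where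
  "transport K \<Phi> \<omega> = \<Phi> \<omega> \<bind> K \<omega>"

text \<open>A finite signed measure on the sigma-algebra of \<open>N\<close> is represented by its set function
  \<open>\<nu>\<close>.  Its integral is taken along any decomposition of \<open>\<nu>\<close> into a difference of finite
  measures; \<open>signed_integral_eq\<close> below shows that the choice does not matter.\<close>

definition signed_integral ::
  "'b measure \<Rightarrow> ('b set \<Rightarrow> real) \<Rightarrow> ('b \<Rightarrow> real) \<Rightarrow> real" where
  "signed_integral N \<nu> f = (THE I. \<exists>\<mu>1 \<mu>2.
     finite_measure \<mu>1 \<and> finite_measure \<mu>2 \<and> sets \<mu>1 = sets N \<and> sets \<mu>2 = sets N \<and>
     (\<forall>A\<in>sets N. \<nu> A = measure \<mu>1 A - measure \<mu>2 A) \<and>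
     I = (\<integral>x. f x \<partial>\<mu>1) - (\<integral>x. f x \<partial>\<mu>2))"

definition signed_norm :: "'b measure \<Rightarrow> ('b set \<Rightarrow> real) \<Rightarrow> real" where
  "signed_norm N \<nu> =
     (SUP f \<in> {f \<in> borel_measurable N. \<forall>x. f x \<in> {-1..1}}. \<bar>signed_integral N \<nu> f\<bar>)"

definition kappa ::
  "('a::euclidean_space \<Rightarrow> 'w measure) \<Rightarrow> ('w \<Rightarrow> 'a \<Rightarrow> 'a measure) \<Rightarrow>
     ('w \<Rightarrow> 'a \<Rightarrow> 'a measure) \<Rightarrow> 'a \<Rightarrow> real" where
  "kappa Q K L y = signed_norm (borel \<Otimes>\<^sub>M borel)
     (\<lambda>C. \<integral>\<omega>. (measure (K \<omega> y \<Otimes>\<^sub>M K \<omega> 0) C - measure (L \<omega> y \<Otimes>\<^sub>M L \<omega> 0) C) \<partial>Q y)"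

definition convex_window :: "'a::euclidean_space set \<Rightarrow> bool" where
  "convex_window W \<longleftrightarrow> convex W \<and> bounded W \<and> 0 \<in> interior W"

text \<open>Asymptotic variances are considered for locally square-integrable random measures only.
  The value \<open>c\<close> is extended real, so that divergence to infinity counts as a limit.  A bounded
  convex set \<open>W\<close> need not be Borel: volume is therefore taken with respect to \<open>lebesgue\<close>, and
  \<open>measure (\<Psi> \<omega>) (scale r W)\<close> has its intended meaning for Borel \<open>W\<close>.\<close>

definition has_asymptotic_variance ::
  "'w measure \<Rightarrow> 'a::euclidean_space set \<Rightarrow> ('w \<Rightarrow> 'a measure) \<Rightarrow> ereal \<Rightarrow> bool" where
  "has_asymptotic_variance M W \<Psi> c \<longleftrightarrow>
     locally_square_integrable M \<Psi> \<and>
     ((\<lambda>r. ereal (prob_space.variance M (\<lambda>\<omega>. measure (\<Psi> \<omega>) (scale r W)) /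
                  measure lebesgue (scale r W))) \<longlongrightarrow> c) at_top"

text \<open>The notion of hyperuniformity presupposes stationarity.  The law of a random measure is taken on the product sigma-algebra generated by the
  evaluations at Borel sets.\<close>

definition stationary :: "'w measure \<Rightarrow> ('w \<Rightarrow> 'a::euclidean_space measure) \<Rightarrow> bool" where
  "stationary M \<Psi> \<longleftrightarrow>
     (\<forall>x. distr M (\<Pi>\<^sub>M B\<in>sets borel. borel)
             (\<lambda>\<omega>. \<lambda>B\<in>sets borel. emeasure (\<Psi> \<omega>) (translate x B)) =
          distr M (\<Pi>\<^sub>M B\<in>sets borel. borel)
             (\<lambda>\<omega>. \<lambda>B\<in>sets borel. emeasure (\<Psi> \<omega>) B))"

definition hyperuniform ::
  "'w measure \<Rightarrow> 'a::euclidean_space set \<Rightarrow> ('w \<Rightarrow> 'a measure) \<Rightarrow> bool" where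
  "hyperuniform M W \<Psi> \<longleftrightarrow> stationary M \<Psi> \<and> has_asymptotic_variance M W \<Psi> 0"

lemma nn_integral_eq_of_measure_diff_eq:
  fixes u :: "'b \<Rightarrow> ennreal"
  assumes fin: "finite_measure a" "finite_measure b" "finite_measure c" "finite_measure d"
    and s: "sets a = sets N" "sets b = sets N" "sets c = sets N" "sets d = sets N"
    and eq: "\<And>A. A \<in> sets N \<Longrightarrow> measure a A - measure b A = measure c A - measure d A"
    and u: "u \<in> borel_measurable N"
  shows "(\<integral>\<^sup>+x. u x \<partial>a) + (\<integral>\<^sup>+x. u x \<partial>d) = (\<integral>\<^sup>+x. u x \<partial>c) + (\<integral>\<^sup>+x. u x \<partial>b)"
  using u
proof (induct rule: borel_measurable_induct)
  have sp: "space a = space N" "space b = space N" "space c = space N" "space d = space N"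
    using s by (auto dest: sets_eq_imp_space_eq)
  note ms = measurable_cong_sets[OF s(1) refl] measurable_cong_sets[OF s(2) refl]
    measurable_cong_sets[OF s(3) refl] measurable_cong_sets[OF s(4) refl]
  {
    case (cong f g)
    have "(\<integral>\<^sup>+x. f x \<partial>a) = (\<integral>\<^sup>+x. g x \<partial>a)" "(\<integral>\<^sup>+x. f x \<partial>b) = (\<integral>\<^sup>+x. g x \<partial>b)"
      "(\<integral>\<^sup>+x. f x \<partial>c) = (\<integral>\<^sup>+x. g x \<partial>c)" "(\<integral>\<^sup>+x. f x \<partial>d) = (\<integral>\<^sup>+x. g x \<partial>d)"
      using cong sp by (auto intro!: nn_integral_cong)
    then show ?case using cong by simp
  next
    case (set A)
    have "measure a A + measure d A = measure c A + measure b A"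
      using eq[OF set] by simp
    then have "ennreal (measure a A) + ennreal (measure d A)
      = ennreal (measure c A) + ennreal (measure b A)"
      by (simp flip: ennreal_plus)
    then show ?case
      using set fin s by (simp add: finite_measure.emeasure_eq_measure)
  next
    case (mult u k)
    then show ?case by (simp only: ms nn_integral_cmult distrib_left[symmetric])
  next
    case (add u v)
    then show ?case using add by (simp only: ms nn_integral_add) (simp only: ac_simps add_left_imp_eq, metis add.assoc add.commute)
  next
    case (seq U)
    have *: "(\<integral>\<^sup>+x. (SUP i. U i) x \<partial>m) = (SUP i. \<integral>\<^sup>+x. U i x \<partial>m)"
      if "sets m = sets N" for m
    proof -
      have "U i \<in> borel_measurable m" for i
        using seq(1) measurable_cong_sets[OF that refl] by blast
      then have "(\<integral>\<^sup>+x. (SUP i. U i x) \<partial>m) = (SUP i. \<integral>\<^sup>+x. U i x \<partial>m)"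
        by (rule nn_integral_monotone_convergence_SUP[OF \<open>incseq U\<close>])
      then show ?thesis by (simp add: image_comp)
    qed
    have inc: "incseq (\<lambda>i. \<integral>\<^sup>+x. U i x \<partial>m)" for m
      using \<open>incseq U\<close> by (auto simp: incseq_def le_fun_def intro!: nn_integral_mono)
    show ?case
      unfolding *[OF s(1)] *[OF s(2)] *[OF s(3)] *[OF s(4)]
      using seq by (simp add: ennreal_SUP_add[symmetric] inc)
  }
qed

lemma signed_integral_eq:
  assumes fin: "finite_measure a" "finite_measure b"
    and s: "sets a = sets N" "sets b = sets N"
    and \<nu>: "\<And>A. A \<in> sets N \<Longrightarrow> \<nu> A = measure a A - measure b A"
    and f: "f \<in> borel_measurable N" and bd: "\<And>x. \<bar>f x\<bar> \<le> C"
  shows "signed_integral N \<nu> f = (\<integral>x. f x \<partial>a) - (\<integral>x. f x \<partial>b)"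
  unfolding signed_integral_def
proof (rule the_equality)
  show "\<exists>\<mu>1 \<mu>2. finite_measure \<mu>1 \<and> finite_measure \<mu>2 \<and> sets \<mu>1 = sets N \<and> sets \<mu>2 = sets N \<and>
     (\<forall>A\<in>sets N. \<nu> A = measure \<mu>1 A - measure \<mu>2 A) \<and>
     (\<integral>x. f x \<partial>a) - (\<integral>x. f x \<partial>b) = (\<integral>x. f x \<partial>\<mu>1) - (\<integral>x. f x \<partial>\<mu>2)"
    using assms by blast
next
  fix I
  assume "\<exists>\<mu>1 \<mu>2. finite_measure \<mu>1 \<and> finite_measure \<mu>2 \<and> sets \<mu>1 = sets N \<and> sets \<mu>2 = sets N \<and>
     (\<forall>A\<in>sets N. \<nu> A = measure \<mu>1 A - measure \<mu>2 A) \<and>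
     I = (\<integral>x. f x \<partial>\<mu>1) - (\<integral>x. f x \<partial>\<mu>2)"
  then obtain c d where cd: "finite_measure c" "finite_measure d" "sets c = sets N" "sets d = sets N"
     "\<And>A. A\<in>sets N \<Longrightarrow> \<nu> A = measure c A - measure d A"
     and I: "I = (\<integral>x. f x \<partial>c) - (\<integral>x. f x \<partial>d)" by blast
  have int: "(\<integral>\<^sup>+x. ennreal (f x + C) \<partial>m) = ennreal ((\<integral>x. f x \<partial>m) + C * measure m (space N))"
    "0 \<le> (\<integral>x. f x \<partial>m) + C * measure m (space N)"
    if m: "finite_measure m" "sets m = sets N" for m
  proof -
    interpret finite_measure m by fact
    have fm: "f \<in> borel_measurable m" using f measurable_cong_sets[OF m(2) refl] by blast
    have i: "integrable m f"
      by (rule integrable_const_bound[of _ C]) (use bd fm in auto)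
    have p: "0 \<le> f x + C" for x using bd[of x] by linarith
    have e: "(\<integral>x. f x + C \<partial>m) = (\<integral>x. f x \<partial>m) + C * measure m (space N)"
      using i by (simp add: sets_eq_imp_space_eq[OF m(2)] mult.commute)
    have "0 \<le> (\<integral>x. f x + C \<partial>m)" by (rule integral_nonneg_AE) (use p in auto)
    then show "0 \<le> (\<integral>x. f x \<partial>m) + C * measure m (space N)" using e by simp
    show "(\<integral>\<^sup>+x. ennreal (f x + C) \<partial>m) = ennreal ((\<integral>x. f x \<partial>m) + C * measure m (space N))"
      unfolding e[symmetric] by (rule nn_integral_eq_integral) (use i p in auto)
  qed
  have deq: "measure a A - measure b A = measure c A - measure d A" if "A \<in> sets N" for A
    using \<nu> cd(5) that by metis
  have "(\<integral>\<^sup>+x. ennreal (f x + C) \<partial>a) + (\<integral>\<^sup>+x. ennreal (f x + C) \<partial>d)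
      = (\<integral>\<^sup>+x. ennreal (f x + C) \<partial>c) + (\<integral>\<^sup>+x. ennreal (f x + C) \<partial>b)"
    by (rule nn_integral_eq_of_measure_diff_eq[of a b c d N])
       (use fin s cd deq f in auto)
  then have "((\<integral>x. f x \<partial>a) + C * measure a (space N)) + ((\<integral>x. f x \<partial>d) + C * measure d (space N))
    = ((\<integral>x. f x \<partial>c) + C * measure c (space N)) + ((\<integral>x. f x \<partial>b) + C * measure b (space N))"
    using int[of a] int[of b] int[of c] int[of d] fin s cd
    by (simp flip: ennreal_plus)
  moreover have "C * (measure a (space N) - measure b (space N))
    = C * (measure c (space N) - measure d (space N))"
    using deq[of "space N"] by simp
  ultimately show "I = (\<integral>x. f x \<partial>a) - (\<integral>x. f x \<partial>b)"
    unfolding I by (simp add: algebra_simps)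
qed

end

theory Submission
  imports Defs
begin

text \<open>By mass transport, \<open>K\<Phi>\<close> and \<open>L\<Phi>\<close> have the same mean \<open>\<gamma> \<lambda>\<close>, so only second moments have to be
  compared. Invariance and the two-point Palm formula give
  \<open>E (K\<Phi> B)\<^sup>2 = \<integral> E\<^sub>0\<^sub>,\<^sub>y (\<integral> \<lambda>((B - u) \<inter> (B - v)) (K\<^sub>y \<otimes> K\<^sub>0)(d(u, v))) \<alpha>(dy)\<close>.
  The normalised overlap \<open>\<lambda>((B - u) \<inter> (B - v)) / \<lambda>(B)\<close> lies in the unit interval, so its integrals
  for \<open>K\<close> and \<open>L\<close> differ by at most \<open>\<kappa>(y)\<close>; for \<open>B = rW\<close> it tends to 1 pointwise as \<open>r\<close> grows,
  because the boundary of a convex set is a null set. Dominated convergence along sequences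
  \<open>r\<^sub>n\<close> then shows that the difference of the normalised variances vanishes in the limit.\<close>

section \<open>Random measures and invariance\<close>

text \<open>The terms cannot be treated one at a time. The normalised squared mean is
  \<open>\<gamma>\<^sup>2 \<lambda>(B)\<close>, and the normalised second moment integrates over
  \<alpha>, which need not be finite, a function that tends to 1 as the window grows. So the squared
  means must cancel exactly, and a limit can be taken only in the difference of the two integrands.
  The norm in \<open>kappa\<close> makes this possible: a supremum over all test functions controls
  every window simultaneously. That the difference vanishes presupposes no limit for either
  variance, so existence and value pass in both directions, infinity included. Local
  square-integrability is part of what has to be passed on, and the same domination achieves that.
  The version \<open>Q\<close> is fixed, and the statements about it hold for every
  \<open>y\<close>, so no exceptional null set has to be tracked.\<close>

lemma random_measure_sets:
  "random_measure M \<Phi> \<Longrightarrow> \<omega> \<in> space M \<Longrightarrow> sets (\<Phi> \<omega>) = sets borel"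
  by (simp add: random_measure_def)

lemma random_measure_space:
  "random_measure M \<Phi> \<Longrightarrow> \<omega> \<in> space M \<Longrightarrow> space (\<Phi> \<omega>) = UNIV"
  using sets_eq_imp_space_eq[OF random_measure_sets] by fastforce

lemma random_measure_finite:
  "random_measure M \<Phi> \<Longrightarrow> \<omega> \<in> space M \<Longrightarrow> B \<in> sets borel \<Longrightarrow> bounded B \<Longrightarrow> emeasure (\<Phi> \<omega>) B < \<infinity>"
  by (simp add: random_measure_def)

lemma random_measure_sigma_finite:
  fixes \<Phi> :: "'w \<Rightarrow> 'a::euclidean_space measure"
  assumes rm: "random_measure M \<Phi>" and w: "\<omega> \<in> space M"
  shows "sigma_finite_measure (\<Phi> \<omega>)"
proof
  have U: "(\<Union>n::nat. ball (0::'a) (real n)) = UNIV"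
    by (auto simp: dist_norm intro: reals_Archimedean2)
  show "\<exists>A. countable A \<and> A \<subseteq> sets (\<Phi> \<omega>) \<and> \<Union> A = space (\<Phi> \<omega>) \<and> (\<forall>a\<in>A. emeasure (\<Phi> \<omega>) a \<noteq> \<infinity>)"
    using U random_measure_finite[OF rm w] random_measure_sets[OF rm w] random_measure_space[OF rm w]
    by (intro exI[of _ "range (\<lambda>n. ball 0 (real n))"]) (auto simp: less_top[symmetric])
qed

text \<open>\<open>random_measure\<close> gives measurability only for evaluations at fixed Borel
  sets; integrands that themselves depend on \<omega> need this lemma. The base \<open>N\<close> is
  left free because it is also applied over \<open>M\<close> times Borel, to carry an extra
  parameter.\<close>

lemma measurable_nn_integral_random_measure:
  fixes \<Phi> :: "'w \<Rightarrow> 'a::euclidean_space measure"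
  assumes rm: "random_measure N \<Phi>" and f[measurable]: "f \<in> borel_measurable (N \<Otimes>\<^sub>M borel)"
  shows "(\<lambda>\<omega>. \<integral>\<^sup>+x. f (\<omega>, x) \<partial>\<Phi> \<omega>) \<in> borel_measurable N"
proof -
  \<comment> \<open>Restricted to a ball and normalised, \<open>\<Phi>\<close> is a subprobability kernel.\<close>
  define A where "A n = (ball 0 (real n) :: 'a set)" for n :: nat
  have A[measurable]: "A n \<in> sets borel" for n by (simp add: A_def)
  have bA: "bounded (A n)" for n by (simp add: A_def)
  have ev[measurable]: "(\<lambda>\<omega>. emeasure (\<Phi> \<omega>) B) \<in> borel_measurable N" if "B \<in> sets borel" for B
    using rm that by (simp add: random_measure_def)
  \<comment> \<open>The summand 1 keeps the normalisation nonzero where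
    \<open>\<Phi> \<omega>\<close> has no mass in the ball, so that multiplying back by
    \<open>c n \<omega>\<close> cancels the division.\<close>
  define c where "c n \<omega> = 1 + emeasure (\<Phi> \<omega>) (A n)" for n \<omega>
  have c[measurable]: "c n \<in> borel_measurable N" for n unfolding c_def by measurable
  have c0: "c n \<omega> \<noteq> 0" for n \<omega> by (simp add: c_def)
  have cfin: "c n \<omega> \<noteq> \<infinity>" if "\<omega> \<in> space N" for n \<omega>
    using random_measure_finite[OF rm that A bA[of n]] by (simp add: c_def less_top[symmetric])
  define P where "P n \<omega> = density (\<Phi> \<omega>) (\<lambda>x. indicator (A n) x / c n \<omega>)" for n \<omega>
  have s: "sets (\<Phi> \<omega>) = sets borel" if "\<omega> \<in> space N" for \<omega> using random_measure_sets[OF rm that] .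
  have P_em: "emeasure (P n \<omega>) B = emeasure (\<Phi> \<omega>) (A n \<inter> B) / c n \<omega>"
    if "\<omega> \<in> space N" "B \<in> sets borel" for n \<omega> B
  proof -
    have "emeasure (P n \<omega>) B = (\<integral>\<^sup>+x. inverse (c n \<omega>) * indicator (A n \<inter> B) x \<partial>\<Phi> \<omega>)"
      unfolding P_def using that s[OF that(1)]
      by (subst emeasure_density)
         (auto intro!: nn_integral_cong borel_measurable_divide_ennreal simp: divide_ennreal_def mult.commute indicator_def)
    also have "\<dots> = inverse (c n \<omega>) * emeasure (\<Phi> \<omega>) (A n \<inter> B)"
      using that s[OF that(1)] by (subst nn_integral_cmult_indicator) auto
    finally show ?thesis by (simp add: divide_ennreal_def mult.commute)
  qed
  have P[measurable]: "P n \<in> N \<rightarrow>\<^sub>M subprob_algebra borel" for n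
  proof (rule measurable_subprob_algebra)
    fix \<omega> assume w: "\<omega> \<in> space N"
    show "sets (P n \<omega>) = sets borel" using s[OF w] by (simp add: P_def)
    have sp: "space (P n \<omega>) = UNIV" using random_measure_space[OF rm w] by (simp add: P_def)
    show "subprob_space (P n \<omega>)"
    proof
      have "emeasure (\<Phi> \<omega>) (A n) / c n \<omega> \<le> c n \<omega> / c n \<omega>"
        by (rule divide_right_mono_ennreal) (simp add: c_def)
      also have "\<dots> = 1" using c0 cfin[OF w] by (simp add: ennreal_divide_self less_top[symmetric] zero_less_iff_neq_zero)
      finally show "emeasure (P n \<omega>) (space (P n \<omega>)) \<le> 1" using P_em[OF w] sp by simp
    qed (use sp in simp)
  next
    fix B :: "'a set" assume B[measurable]: "B \<in> sets borel"
    have "(\<lambda>\<omega>. emeasure (\<Phi> \<omega>) (A n \<inter> B) / c n \<omega>) \<in> borel_measurable N" by measurable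
    then show "(\<lambda>\<omega>. emeasure (P n \<omega>) B) \<in> borel_measurable N"
      using P_em B by (subst measurable_cong) auto
  qed
  have eq: "(\<integral>\<^sup>+x. f (\<omega>, x) \<partial>\<Phi> \<omega>) = (SUP n. c n \<omega> * (\<integral>\<^sup>+x. f (\<omega>, x) \<partial>P n \<omega>))" if w: "\<omega> \<in> space N" for \<omega>
  proof -
    have fm: "(\<lambda>x. f (\<omega>, x)) \<in> borel_measurable (\<Phi> \<omega>)"
      using f w s[OF w] by (simp cong: measurable_cong_sets) 
    have "c n \<omega> * (\<integral>\<^sup>+x. f (\<omega>, x) \<partial>P n \<omega>) = (\<integral>\<^sup>+x. f (\<omega>, x) * indicator (A n) x \<partial>\<Phi> \<omega>)" for n
    proof -
      have "(\<integral>\<^sup>+x. f (\<omega>, x) \<partial>P n \<omega>) = (\<integral>\<^sup>+x. indicator (A n) x / c n \<omega> * f (\<omega>, x) \<partial>\<Phi> \<omega>)"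
        unfolding P_def using s[OF w] fm by (intro nn_integral_density) auto
      also have "\<dots> = (\<integral>\<^sup>+x. inverse (c n \<omega>) * (f (\<omega>, x) * indicator (A n) x) \<partial>\<Phi> \<omega>)"
        by (intro nn_integral_cong) (simp add: divide_ennreal_def ac_simps)
      also have "\<dots> = inverse (c n \<omega>) * (\<integral>\<^sup>+x. f (\<omega>, x) * indicator (A n) x \<partial>\<Phi> \<omega>)"
        using s[OF w] fm by (intro nn_integral_cmult) auto
      finally have "c n \<omega> * (\<integral>\<^sup>+x. f (\<omega>, x) \<partial>P n \<omega>) 
        = (c n \<omega> * inverse (c n \<omega>)) * (\<integral>\<^sup>+x. f (\<omega>, x) * indicator (A n) x \<partial>\<Phi> \<omega>)" by (simp add: ac_simps)
      also have "c n \<omega> * inverse (c n \<omega>) = 1"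
        using c0 cfin[OF w] by (metis ennreal_divide_self divide_ennreal_def zero_less_iff_neq_zero less_top infinity_ennreal_def)
      finally show ?thesis by simp
    qed
    moreover have "(SUP n. \<integral>\<^sup>+x. f (\<omega>, x) * indicator (A n) x \<partial>\<Phi> \<omega>) = (\<integral>\<^sup>+x. (SUP n. f (\<omega>, x) * indicator (A n) x) \<partial>\<Phi> \<omega>)"
      using s[OF w] fm
      by (intro nn_integral_monotone_convergence_SUP[symmetric])
         (auto simp: incseq_def le_fun_def A_def indicator_def)
    moreover have "(SUP n. f (\<omega>, x) * indicator (A n) x) = f (\<omega>, x)" for x
    proof (rule antisym)
      obtain n :: nat where "norm x < n" using reals_Archimedean2 by blast
      then have "f (\<omega>, x) * indicator (A n) x = f (\<omega>, x)" by (simp add: A_def)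
      then show "f (\<omega>, x) \<le> (SUP n. f (\<omega>, x) * indicator (A n) x)" by (metis SUP_upper UNIV_I)
    qed (auto intro!: SUP_least simp: indicator_def)
    ultimately show ?thesis by simp
  qed
  have "(\<lambda>\<omega>. SUP n. c n \<omega> * (\<integral>\<^sup>+x. f (\<omega>, x) \<partial>P n \<omega>)) \<in> borel_measurable N"
    by (intro borel_measurable_SUP borel_measurable_times_ennreal c
       nn_integral_measurable_subprob_algebra2[OF _ P]) auto
  then show ?thesis using eq by (subst measurable_cong) auto
qed

section \<open>Translations and the measure-preserving flow\<close>

lemma translate_eq_vimage: "translate x B = (\<lambda>b. b - x) -` B"
  unfolding translate_def by (force simp: image_iff algebra_simps)

lemma sets_translate [measurable]:
  "B \<in> sets borel \<Longrightarrow> translate x B \<in> sets borel"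
proof -
  assume B: "B \<in> sets borel"
  have "(\<lambda>b. b - x) -` B \<inter> space borel \<in> sets borel"
    by (rule measurable_sets[OF _ B]) simp
  then show ?thesis by (simp add: translate_eq_vimage)
qed

lemma translate_translate: "translate x (translate y B) = translate (x + y) B"
  by (simp add: translate_eq_vimage vimage_def algebra_simps)

lemma stationary_flow_measurable:
  assumes "stationary_flow M \<theta>"
  shows "(\<lambda>(\<omega>, x). \<theta> x \<omega>) \<in> M \<Otimes>\<^sub>M borel \<rightarrow>\<^sub>M M" "\<theta> x \<in> M \<rightarrow>\<^sub>M M"
proof -
  show *: "(\<lambda>(\<omega>, x). \<theta> x \<omega>) \<in> M \<Otimes>\<^sub>M borel \<rightarrow>\<^sub>M M"
    using assms by (simp add: stationary_flow_def)
  show "\<theta> x \<in> M \<rightarrow>\<^sub>M M"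
    using measurable_compose[OF measurable_Pair2'[of x borel M] *] by simp
qed

lemma stationary_flow_space:
  "stationary_flow M \<theta> \<Longrightarrow> \<omega> \<in> space M \<Longrightarrow> \<theta> x \<omega> \<in> space M"
  using measurable_space[OF stationary_flow_measurable(2)] .

lemma stationary_flow_add:
  "stationary_flow M \<theta> \<Longrightarrow> \<omega> \<in> space M \<Longrightarrow> \<theta> x (\<theta> y \<omega>) = \<theta> (x + y) \<omega>"
  by (simp add: stationary_flow_def)

lemma stationary_flow_zero:
  "stationary_flow M \<theta> \<Longrightarrow> \<omega> \<in> space M \<Longrightarrow> \<theta> 0 \<omega> = \<omega>"
  by (simp add: stationary_flow_def)

text \<open>\<open>stationary_flow\<close> states invariance for images. Since
  \<open>\<theta> (- x)\<close> inverts \<open>\<theta> x\<close> on \<open>space M\<close>, a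
  preimage under \<open>\<theta> x\<close> is an image under \<open>\<theta> (- x)\<close>, and
  invariance at \<open>- x\<close> applies.\<close>

lemma stationary_flow_distr:
  assumes fl: "stationary_flow M \<theta>"
  shows "distr M M (\<theta> x) = M"
proof (rule measure_eqI)
  fix A assume "A \<in> sets (distr M M (\<theta> x))"
  then have A: "A \<in> sets M" by simp
  have "\<theta> x -` A \<inter> space M = \<theta> (- x) ` A"
  proof (intro equalityI subsetI)
    fix \<omega> assume "\<omega> \<in> \<theta> x -` A \<inter> space M"
    then have "\<theta> x \<omega> \<in> A" "\<omega> = \<theta> (- x) (\<theta> x \<omega>)"
      using fl by (auto simp: stationary_flow_add stationary_flow_zero)
    then show "\<omega> \<in> \<theta> (- x) ` A" by blast
  next
    fix \<omega> assume "\<omega> \<in> \<theta> (- x) ` A"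
    then obtain \<omega>' where "\<omega>' \<in> A" "\<omega> = \<theta> (- x) \<omega>'" by blast
    moreover from this have "\<omega>' \<in> space M" using A sets.sets_into_space by blast
    ultimately show "\<omega> \<in> \<theta> x -` A \<inter> space M"
      using fl by (auto simp: stationary_flow_add stationary_flow_zero stationary_flow_space)
  qed
  then show "emeasure (distr M M (\<theta> x)) A = emeasure M A"
    using fl A by (simp add: emeasure_distr stationary_flow_measurable(2) stationary_flow_def)
qed simp

lemma nn_integral_stationary_flow:
  assumes fl: "stationary_flow M \<theta>" and f: "f \<in> borel_measurable M"
  shows "(\<integral>\<^sup>+\<omega>. f (\<theta> x \<omega>) \<partial>M) = (\<integral>\<^sup>+\<omega>. f \<omega> \<partial>M)"
  using nn_integral_distr[OF stationary_flow_measurable(2)[OF fl], of f x] f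
  by (simp add: stationary_flow_distr[OF fl])

text \<open>\<open>translate x B\<close> is the preimage of \<open>B\<close> under subtraction of
  \<open>x\<close>, so invariance on sets says that the flow pushes \<open>\<Phi> \<omega>\<close>
  forward by this shift; in this form it transfers to integrals.\<close>

lemma invariant_measure_distr:
  assumes fl: "stationary_flow M \<theta>" and rm: "random_measure M \<Phi>"
    and inv: "invariant_measure M \<theta> \<Phi>" and w: "\<omega> \<in> space M"
  shows "\<Phi> (\<theta> x \<omega>) = distr (\<Phi> \<omega>) borel (\<lambda>z. z - x)"
proof (rule measure_eqI)
  have s: "sets (\<Phi> \<omega>) = sets borel" by (rule random_measure_sets[OF rm w])
  show s': "sets (\<Phi> (\<theta> x \<omega>)) = sets (distr (\<Phi> \<omega>) borel (\<lambda>z. z - x))"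
    using random_measure_sets[OF rm stationary_flow_space[OF fl w]] by simp
  fix B assume "B \<in> sets (\<Phi> (\<theta> x \<omega>))"
  then have B: "B \<in> sets borel" using s' by simp
  have "emeasure (distr (\<Phi> \<omega>) borel (\<lambda>z. z - x)) B = emeasure (\<Phi> \<omega>) (translate x B)"
    using B s random_measure_space[OF rm w]
    by (subst emeasure_distr) (auto simp: translate_eq_vimage cong: measurable_cong_sets)
  then show "emeasure (\<Phi> (\<theta> x \<omega>)) B = emeasure (distr (\<Phi> \<omega>) borel (\<lambda>z. z - x)) B"
    using inv w B by (simp add: invariant_measure_def)
qed

lemma nn_integral_invariant_measure:
  assumes fl: "stationary_flow M \<theta>" and rm: "random_measure M \<Phi>"
    and inv: "invariant_measure M \<theta> \<Phi>" and w: "\<omega> \<in> space M" and f: "f \<in> borel_measurable borel"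
  shows "(\<integral>\<^sup>+z. f z \<partial>\<Phi> (\<theta> x \<omega>)) = (\<integral>\<^sup>+z. f (z - x) \<partial>\<Phi> \<omega>)"
  unfolding invariant_measure_distr[OF fl rm inv w]
  using random_measure_sets[OF rm w] f
  by (intro nn_integral_distr) (auto cong: measurable_cong_sets)

section \<open>Invariant kernels\<close>

lemma invariant_prob_kernel_measurable:
  assumes "invariant_prob_kernel M \<theta> K"
  shows "(\<lambda>(\<omega>, x). K \<omega> x) \<in> M \<Otimes>\<^sub>M borel \<rightarrow>\<^sub>M prob_algebra borel"
  using assms by (simp add: invariant_prob_kernel_def)

lemma invariant_prob_kernel_measurable_compose:
  assumes K: "invariant_prob_kernel M \<theta> K" and f: "f \<in> N \<rightarrow>\<^sub>M M" and g: "g \<in> N \<rightarrow>\<^sub>M borel"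
  shows "(\<lambda>p. K (f p) (g p)) \<in> N \<rightarrow>\<^sub>M prob_algebra borel"
  using measurable_compose[OF measurable_Pair[OF f g] invariant_prob_kernel_measurable[OF K]] by simp

lemma invariant_prob_kernel_prob_space:
  assumes K: "invariant_prob_kernel M \<theta> K" and w: "\<omega> \<in> space M"
  shows "prob_space (K \<omega> x)" "sets (K \<omega> x) = sets borel" "space (K \<omega> x) = UNIV"
proof -
  have "K \<omega> x \<in> space (prob_algebra borel)"
    using measurable_space[OF invariant_prob_kernel_measurable[OF K], of "(\<omega>, x)"] w
    by (simp add: space_pair_measure)
  then show "prob_space (K \<omega> x)" "sets (K \<omega> x) = sets borel" "space (K \<omega> x) = UNIV"
    by (auto simp: space_prob_algebra dest: sets_eq_imp_space_eq)
qed

text \<open>The definition of invariance allows only the starting point 0 on the shifted side. Using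
  it twice, once at \<open>\<theta> x \<omega>\<close> and once at \<omega>, meets in
  \<open>\<theta> (z + x) \<omega>\<close> and frees the starting point \<open>z\<close>.\<close>

lemma invariant_prob_kernel_shift:
  assumes fl: "stationary_flow M \<theta>" and K: "invariant_prob_kernel M \<theta> K"
    and w: "\<omega> \<in> space M" and B: "B \<in> sets borel"
  shows "emeasure (K (\<theta> x \<omega>) z) B = emeasure (K \<omega> (z + x)) (translate x B)"
proof -
  have inv: "emeasure (K \<omega> x) (translate x B) = emeasure (K (\<theta> x \<omega>) 0) B"
    if "\<omega> \<in> space M" "B \<in> sets borel" for \<omega> x B
    using K that by (simp add: invariant_prob_kernel_def)
  \<comment> \<open>\<open>B\<close> is written as a translate by \<open>z\<close> to match the left
    side of the definition.\<close>
  have "emeasure (K (\<theta> x \<omega>) z) (translate z (translate (- z) B)) = emeasure (K (\<theta> (z + x) \<omega>) 0) (translate (- z) B)"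
    using B stationary_flow_add[OF fl w, of z x] by (subst inv) (auto simp: stationary_flow_space[OF fl w])
  also have "\<dots> = emeasure (K \<omega> (z + x)) (translate (z + x) (translate (- z) B))"
    by (rule inv[symmetric]) (use w B in auto)
  finally show ?thesis
    by (simp add: translate_translate) (simp add: translate_eq_vimage)
qed

section \<open>The transported random measure\<close>

lemma emeasure_transport:
  assumes rm: "random_measure M \<Phi>" and K: "invariant_prob_kernel M \<theta> K"
    and w: "\<omega> \<in> space M" and B: "B \<in> sets borel"
  shows "emeasure (transport K \<Phi> \<omega>) B = (\<integral>\<^sup>+x. emeasure (K \<omega> x) B \<partial>\<Phi> \<omega>)"
  unfolding transport_def
proof (rule emeasure_bind[OF _ _ B])
  show "space (\<Phi> \<omega>) \<noteq> {}" using random_measure_space[OF rm w] by simp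
  have "K \<omega> \<in> borel \<rightarrow>\<^sub>M subprob_algebra borel"
    using measurable_prob_algebraD[OF invariant_prob_kernel_measurable_compose[OF K, of "\<lambda>_. \<omega>" borel "\<lambda>x. x"]] w
    by simp
  then show "K \<omega> \<in> \<Phi> \<omega> \<rightarrow>\<^sub>M subprob_algebra borel"
    using random_measure_sets[OF rm w] by (simp cong: measurable_cong_sets)
qed

text \<open>The set moves with the parameter, so measurability of evaluations at fixed sets is not
  enough. Writing the value as the integral of \<open>indicator B (b - h p)\<close> puts this
  dependence into a jointly measurable integrand.\<close>

lemma measurable_emeasure_kernel:
  assumes K: "invariant_prob_kernel M \<theta> K" and f: "f \<in> N \<rightarrow>\<^sub>M M" and g: "g \<in> N \<rightarrow>\<^sub>M borel"
    and h: "h \<in> borel_measurable N" and B: "B \<in> sets borel"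
  shows "(\<lambda>p. emeasure (K (f p) (g p)) (translate (h p) B)) \<in> borel_measurable N"
proof -
  note [measurable] = B h
  have "(\<lambda>p. \<integral>\<^sup>+b. indicator B (b - h p) \<partial>K (f p) (g p)) \<in> borel_measurable N"
    by (rule nn_integral_measurable_subprob_algebra2[OF _ measurable_prob_algebraD[OF invariant_prob_kernel_measurable_compose[OF K f g]]])
       measurable
  moreover have "(\<integral>\<^sup>+b. indicator B (b - h p) \<partial>K (f p) (g p)) = emeasure (K (f p) (g p)) (translate (h p) B)"
    if "p \<in> space N" for p
  proof -
    have "sets (K (f p) (g p)) = sets borel"
      using invariant_prob_kernel_prob_space(2)[OF K] measurable_space[OF f that] .
    moreover have "(\<integral>\<^sup>+b. indicator B (b - h p) \<partial>K (f p) (g p)) = (\<integral>\<^sup>+b. indicator (translate (h p) B) b \<partial>K (f p) (g p))"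
      by (intro nn_integral_cong) (simp add: translate_eq_vimage indicator_def)
    ultimately show ?thesis using sets_translate[OF B] by simp
  qed
  ultimately show ?thesis by (subst measurable_cong[symmetric]) auto
qed

lemma measurable_emeasure_kernel':
  assumes K: "invariant_prob_kernel M \<theta> K" and f: "f \<in> N \<rightarrow>\<^sub>M M" and g: "g \<in> N \<rightarrow>\<^sub>M borel"
    and B: "B \<in> sets borel"
  shows "(\<lambda>p. emeasure (K (f p) (g p)) B) \<in> borel_measurable N"
  using measurable_emeasure_kernel[OF K f g measurable_const B, of 0] by (simp add: translate_eq_vimage)

lemma measurable_emeasure_transport:
  assumes rm: "random_measure M \<Phi>" and K: "invariant_prob_kernel M \<theta> K" and B: "B \<in> sets borel"
  shows "(\<lambda>\<omega>. emeasure (transport K \<Phi> \<omega>) B) \<in> borel_measurable M"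
proof -
  have "(\<lambda>\<omega>. \<integral>\<^sup>+x. (\<lambda>(\<omega>, x). emeasure (K \<omega> x) B) (\<omega>, x) \<partial>\<Phi> \<omega>) \<in> borel_measurable M"
    by (rule measurable_nn_integral_random_measure[OF rm])
       (use measurable_emeasure_kernel'[OF K measurable_fst measurable_snd B] in \<open>simp add: split_beta'\<close>)
  then show ?thesis by (subst measurable_cong[OF emeasure_transport[OF rm K _ B]]) auto
qed

text \<open>Two shifts compensate: invariance of \<Phi> replaces the starting point \<open>z\<close>
  by \<open>z - x\<close>, and \<open>invariant_prob_kernel_shift\<close> turns it back into
  \<open>z\<close> at the price of translating \<open>B\<close> by \<open>x\<close>.\<close>

lemma invariant_measure_transport:
  fixes \<theta> :: "'a::euclidean_space \<Rightarrow> 'w \<Rightarrow> 'w"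
  assumes fl: "stationary_flow M \<theta>" and rm: "random_measure M \<Phi>"
    and inv: "invariant_measure M \<theta> \<Phi>" and K: "invariant_prob_kernel M \<theta> K"
  shows "invariant_measure M \<theta> (transport K \<Phi>)"
  unfolding invariant_measure_def
proof (intro ballI allI)
  fix \<omega> and x :: 'a and B :: "'a set" assume w: "\<omega> \<in> space M" and B: "B \<in> sets borel"
  have w': "\<theta> x \<omega> \<in> space M" using stationary_flow_space[OF fl w] .
  have "emeasure (transport K \<Phi> (\<theta> x \<omega>)) B = (\<integral>\<^sup>+z. emeasure (K (\<theta> x \<omega>) z) B \<partial>\<Phi> (\<theta> x \<omega>))"
    by (rule emeasure_transport[OF rm K w' B])
  also have "\<dots> = (\<integral>\<^sup>+z. emeasure (K (\<theta> x \<omega>) (z - x)) B \<partial>\<Phi> \<omega>)"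
    by (rule nn_integral_invariant_measure[OF fl rm inv w])
       (rule measurable_emeasure_kernel'[OF K _ _ B], use w' in auto)
  also have "\<dots> = (\<integral>\<^sup>+z. emeasure (K \<omega> z) (translate x B) \<partial>\<Phi> \<omega>)"
    by (simp add: invariant_prob_kernel_shift[OF fl K w B])
  also have "\<dots> = emeasure (transport K \<Phi> \<omega>) (translate x B)"
    by (rule emeasure_transport[OF rm K w sets_translate[OF B], symmetric])
  finally show "emeasure (transport K \<Phi> \<omega>) (translate x B) = emeasure (transport K \<Phi> (\<theta> x \<omega>)) B" ..
qed

text \<open>Evaluating at all translated sets is the evaluation map composed with
  \<open>\<theta> x\<close>, so preservation of \<open>M\<close> settles the joint law of all
  evaluations at once.\<close>

lemma stationary_invariant_measure:
  fixes \<Psi> :: "'w \<Rightarrow> 'a::euclidean_space measure"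
  assumes fl: "stationary_flow M \<theta>" and inv: "invariant_measure M \<theta> \<Psi>"
    and ev: "\<And>B. B \<in> sets borel \<Longrightarrow> (\<lambda>\<omega>. emeasure (\<Psi> \<omega>) B) \<in> borel_measurable M"
  shows "stationary M \<Psi>"
  unfolding stationary_def
proof
  fix x :: 'a
  let ?P = "\<Pi>\<^sub>M B\<in>sets (borel :: 'a measure). (borel :: ennreal measure)"
  let ?F = "\<lambda>\<omega>. \<lambda>B\<in>sets borel. emeasure (\<Psi> \<omega>) B"
  have F: "?F \<in> M \<rightarrow>\<^sub>M ?P" by (rule measurable_restrict) (rule ev)
  have "distr M ?P (\<lambda>\<omega>. \<lambda>B\<in>sets borel. emeasure (\<Psi> \<omega>) (translate x B)) = distr M ?P (?F \<circ> \<theta> x)"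
    by (rule distr_cong) (use inv in \<open>auto simp: invariant_measure_def fun_eq_iff\<close>)
  also have "\<dots> = distr (distr M M (\<theta> x)) ?P ?F"
    by (rule distr_distr[symmetric, OF F stationary_flow_measurable(2)[OF fl]])
  finally show "distr M ?P (\<lambda>\<omega>. \<lambda>B\<in>sets borel. emeasure (\<Psi> \<omega>) (translate x B)) = distr M ?P ?F"
    by (simp add: stationary_flow_distr[OF fl])
qed

lemma stationary_transport:
  assumes "stationary_flow M \<theta>" "random_measure M \<Phi>" "invariant_measure M \<theta> \<Phi>" "invariant_prob_kernel M \<theta> K"
  shows "stationary M (transport K \<Phi>)"
  using stationary_invariant_measure invariant_measure_transport measurable_emeasure_transport assms by metis

section \<open>Lebesgue integrals and mass transport\<close>

lemma nn_integral_lborel_translate: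
  fixes f :: "'a::euclidean_space \<Rightarrow> ennreal"
  assumes [measurable]: "f \<in> borel_measurable borel"
  shows "(\<integral>\<^sup>+u. f (x + u) \<partial>lborel) = (\<integral>\<^sup>+u. f u \<partial>lborel)"
proof -
  have "(\<integral>\<^sup>+u. f u \<partial>lborel) = (\<integral>\<^sup>+u. f u \<partial>distr lborel borel ((+) x))"
    by (simp add: lborel_distr_plus)
  then show ?thesis by (simp add: nn_integral_distr)
qed

lemma nn_integral_lborel_reflect:
  fixes f :: "'a::euclidean_space \<Rightarrow> ennreal"
  assumes [measurable]: "f \<in> borel_measurable borel"
  shows "(\<integral>\<^sup>+u. f (x - u) \<partial>lborel) = (\<integral>\<^sup>+u. f u \<partial>lborel)"
proof -
  have "lborel = density (distr lborel borel (\<lambda>u. x + (- 1) *\<^sub>R u)) (\<lambda>_. ennreal (\<bar>- 1 :: real\<bar> ^ DIM('a)))"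
    by (rule lborel_affine) simp
  then have "lborel = distr lborel borel (\<lambda>u. x - u)" by (simp add: density_1)
  then have "(\<integral>\<^sup>+u. f u \<partial>lborel) = (\<integral>\<^sup>+u. f u \<partial>distr lborel borel (\<lambda>u. x - u))" by metis
  then show ?thesis by (simp add: nn_integral_distr)
qed

text \<open>\<open>\<Phi> \<omega>\<close> depends on \<omega>, so its integral cannot be exchanged
  with that over \<open>M\<close>. The Lebesgue integral moves outwards in two Fubini steps instead,
  first past \<open>\<Phi> \<omega>\<close> for fixed \<omega>, then past \<open>M\<close>.\<close>

lemma nn_integral_random_measure_lborel_swap:
  fixes \<Phi> :: "'w \<Rightarrow> 'a::euclidean_space measure" and g :: "'w \<Rightarrow> 'a \<Rightarrow> 'b::euclidean_space \<Rightarrow> ennreal"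
  assumes "prob_space M" and rm: "random_measure M \<Phi>"
    and g: "(\<lambda>((\<omega>, u), x). g \<omega> x u) \<in> borel_measurable ((M \<Otimes>\<^sub>M borel) \<Otimes>\<^sub>M borel)"
  shows "(\<integral>\<^sup>+\<omega>. \<integral>\<^sup>+x. \<integral>\<^sup>+u. g \<omega> x u \<partial>lborel \<partial>\<Phi> \<omega> \<partial>M) = (\<integral>\<^sup>+u. \<integral>\<^sup>+\<omega>. \<integral>\<^sup>+x. g \<omega> x u \<partial>\<Phi> \<omega> \<partial>M \<partial>lborel)"
proof -
  interpret prob_space M by fact
  interpret P: pair_sigma_finite M "lborel :: 'b measure" ..
  have "(\<integral>\<^sup>+x. \<integral>\<^sup>+u. g \<omega> x u \<partial>lborel \<partial>\<Phi> \<omega>) = (\<integral>\<^sup>+u. \<integral>\<^sup>+x. g \<omega> x u \<partial>\<Phi> \<omega> \<partial>lborel)" if w: "\<omega> \<in> space M" for \<omega>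
  proof -
    interpret S: sigma_finite_measure "\<Phi> \<omega>" by (rule random_measure_sigma_finite[OF rm w])
    interpret P': pair_sigma_finite "\<Phi> \<omega>" "lborel :: 'b measure" ..
    note [measurable_cong] = random_measure_sets[OF rm w]
    have "(\<lambda>p. (\<lambda>((\<omega>, u), x). g \<omega> x u) ((\<omega>, snd p), fst p)) \<in> borel_measurable (\<Phi> \<omega> \<Otimes>\<^sub>M lborel)"
      by (rule measurable_compose[OF _ g]) (use w in measurable)
    then show ?thesis
      by (intro P'.Fubini'[symmetric]) (simp add: split_beta')
  qed
  then have "(\<integral>\<^sup>+\<omega>. \<integral>\<^sup>+x. \<integral>\<^sup>+u. g \<omega> x u \<partial>lborel \<partial>\<Phi> \<omega> \<partial>M) = (\<integral>\<^sup>+\<omega>. \<integral>\<^sup>+u. \<integral>\<^sup>+x. g \<omega> x u \<partial>\<Phi> \<omega> \<partial>lborel \<partial>M)"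
    by (intro nn_integral_cong) auto
  also have "\<dots> = (\<integral>\<^sup>+u. \<integral>\<^sup>+\<omega>. \<integral>\<^sup>+x. g \<omega> x u \<partial>\<Phi> \<omega> \<partial>M \<partial>lborel)"
  proof (rule P.Fubini'[symmetric])
    \<comment> \<open>Regarded as a random measure over \<open>M\<close> times Borel that ignores
      \<open>u\<close>, \<Phi> fits the measurability lemma with \<open>u\<close> as a
      parameter.\<close>
    have rm': "random_measure (M \<Otimes>\<^sub>M (borel :: 'b measure)) (\<lambda>p. \<Phi> (fst p))"
      using rm by (auto simp: random_measure_def space_pair_measure intro: measurable_compose[OF measurable_fst])
    have "(\<lambda>p. \<integral>\<^sup>+x. (\<lambda>((\<omega>, u), x). g \<omega> x u) (p, x) \<partial>\<Phi> (fst p)) \<in> borel_measurable (M \<Otimes>\<^sub>M borel)"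
      by (rule measurable_nn_integral_random_measure[OF rm' g])
    then show "(\<lambda>(\<omega>, u). \<integral>\<^sup>+x. g \<omega> x u \<partial>\<Phi> \<omega>) \<in> borel_measurable (M \<Otimes>\<^sub>M lborel)"
      by (simp add: split_beta')
  qed
  finally show ?thesis .
qed

text \<open>By Fubini it suffices to fix \<open>b\<close>: the points \<open>u\<close> with
  \<open>b - u\<close> in \<open>B\<close> form a reflected translate of \<open>B\<close>, and \<mu>
  has total mass 1.\<close>

lemma nn_integral_kernel_translate:
  fixes \<mu> :: "'a::euclidean_space measure"
  assumes "prob_space \<mu>" and s: "sets \<mu> = sets borel" and B[measurable]: "B \<in> sets borel"
  shows "(\<integral>\<^sup>+u. emeasure \<mu> (translate u B) \<partial>lborel) = emeasure lborel B"
proof -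
  interpret prob_space \<mu> by fact
  interpret P: pair_sigma_finite \<mu> "lborel :: 'a measure" ..
  note [measurable_cong] = s
  have "emeasure \<mu> (translate u B) = (\<integral>\<^sup>+b. indicator B (b - u) \<partial>\<mu>)" for u
  proof -
    have "(\<integral>\<^sup>+b. indicator B (b - u) \<partial>\<mu>) = (\<integral>\<^sup>+b. indicator (translate u B) b \<partial>\<mu>)"
      by (intro nn_integral_cong) (simp add: translate_eq_vimage indicator_def)
    then show ?thesis using s sets_translate[OF B] by simp
  qed
  then have "(\<integral>\<^sup>+u. emeasure \<mu> (translate u B) \<partial>lborel) = (\<integral>\<^sup>+u. \<integral>\<^sup>+b. indicator B (b - u) \<partial>\<mu> \<partial>lborel)" by simp
  also have "\<dots> = (\<integral>\<^sup>+b. \<integral>\<^sup>+u. indicator B (b - u) \<partial>lborel \<partial>\<mu>)"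
    by (rule P.Fubini') measurable
  also have "\<dots> = (\<integral>\<^sup>+b. emeasure lborel B \<partial>\<mu>)"
    by (subst nn_integral_lborel_reflect) auto
  finally show ?thesis by (simp add: emeasure_space_1)
qed

text \<open>Mass transport: smearing with the indicator of the unit cube and shifting by the flow moves
  the integration over the whole space from \<open>\<Phi>\<close> to the kernel.\<close>

lemma nn_integral_transport:
  fixes \<Phi> :: "'w \<Rightarrow> 'a::euclidean_space measure"
  assumes pr: "prob_space M" and fl: "stationary_flow M \<theta>" and rm: "random_measure M \<Phi>"
    and inv: "invariant_measure M \<theta> \<Phi>" and K: "invariant_prob_kernel M \<theta> K" and B[measurable]: "B \<in> sets borel"
  shows "(\<integral>\<^sup>+\<omega>. emeasure (transport K \<Phi> \<omega>) B \<partial>M) = intensity M \<Phi> * emeasure lborel B"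
proof -
  \<comment> \<open>The cube is the one in \<open>intensity\<close>; its volume 1 makes it a
    smearing function.\<close>
  define w where "w = (indicator (cbox 0 One) :: 'a \<Rightarrow> ennreal)"
  have w[measurable]: "w \<in> borel_measurable borel" unfolding w_def by measurable
  have w1: "(\<integral>\<^sup>+u. w (x + u) \<partial>lborel) = 1" for x
  proof -
    have "(\<integral>\<^sup>+u. w (x + u) \<partial>lborel) = emeasure lborel (cbox (0::'a) One)"
      by (subst nn_integral_lborel_translate) (auto simp: w_def)
    also have "\<dots> = 1" by (subst emeasure_lborel_cbox) auto
    finally show ?thesis .
  qed
  have Km[measurable]: "(\<lambda>p. emeasure (K (f p) (g p)) (translate (h p) B)) \<in> borel_measurable N"
    if "f \<in> N \<rightarrow>\<^sub>M M" "g \<in> N \<rightarrow>\<^sub>M borel" "h \<in> N \<rightarrow>\<^sub>M borel" for f :: "_ \<Rightarrow> 'w" and g h N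
    using measurable_emeasure_kernel[OF K that B] .
  have Km0[measurable]: "(\<lambda>p. emeasure (K (f p) (g p)) B) \<in> borel_measurable N"
    if "f \<in> N \<rightarrow>\<^sub>M M" "g \<in> N \<rightarrow>\<^sub>M borel" for f :: "_ \<Rightarrow> 'w" and g N
    using measurable_emeasure_kernel'[OF K that B] .
  have "(\<integral>\<^sup>+\<omega>. emeasure (transport K \<Phi> \<omega>) B \<partial>M) = (\<integral>\<^sup>+\<omega>. \<integral>\<^sup>+x. emeasure (K \<omega> x) B \<partial>\<Phi> \<omega> \<partial>M)"
    by (intro nn_integral_cong emeasure_transport[OF rm K _ B])
  also have "\<dots> = (\<integral>\<^sup>+\<omega>. \<integral>\<^sup>+x. \<integral>\<^sup>+u. emeasure (K \<omega> x) B * w (x + u) \<partial>lborel \<partial>\<Phi> \<omega> \<partial>M)"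
    by (subst nn_integral_cmult) (auto simp: w1)
  also have "\<dots> = (\<integral>\<^sup>+u. \<integral>\<^sup>+\<omega>. \<integral>\<^sup>+x. emeasure (K \<omega> x) B * w (x + u) \<partial>\<Phi> \<omega> \<partial>M \<partial>lborel)"
    by (rule nn_integral_random_measure_lborel_swap[OF pr rm]) (simp add: split_beta')
  also have "\<dots> = (\<integral>\<^sup>+u. \<integral>\<^sup>+\<omega>. \<integral>\<^sup>+x. emeasure (K \<omega> x) (translate u B) * w x \<partial>\<Phi> \<omega> \<partial>M \<partial>lborel)"
  proof (rule nn_integral_cong)
    fix u :: 'a
    \<comment> \<open>For fixed \<open>u\<close>, replacing \<omega> by
      \<open>\<theta> u \<omega>\<close> leaves the expectation unchanged; invariance then takes the
      shift out of the cube and puts it on \<open>B\<close>.\<close>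
    have "(\<integral>\<^sup>+\<omega>. \<integral>\<^sup>+x. emeasure (K \<omega> x) B * w (x + u) \<partial>\<Phi> \<omega> \<partial>M)
        = (\<integral>\<^sup>+\<omega>. \<integral>\<^sup>+x. emeasure (K (\<theta> u \<omega>) x) B * w (x + u) \<partial>\<Phi> (\<theta> u \<omega>) \<partial>M)"
    proof (rule nn_integral_stationary_flow[OF fl, symmetric])
      have "(\<lambda>\<omega>. \<integral>\<^sup>+x. (\<lambda>(\<omega>, x). emeasure (K \<omega> x) B * w (x + u)) (\<omega>, x) \<partial>\<Phi> \<omega>) \<in> borel_measurable M"
        by (rule measurable_nn_integral_random_measure[OF rm]) (simp add: split_beta')
      then show "(\<lambda>\<omega>. \<integral>\<^sup>+x. emeasure (K \<omega> x) B * w (x + u) \<partial>\<Phi> \<omega>) \<in> borel_measurable M" by simp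
    qed
    also have "\<dots> = (\<integral>\<^sup>+\<omega>. \<integral>\<^sup>+x. emeasure (K \<omega> x) (translate u B) * w x \<partial>\<Phi> \<omega> \<partial>M)"
    proof (rule nn_integral_cong)
      fix \<omega> assume w: "\<omega> \<in> space M"
      have "(\<integral>\<^sup>+x. emeasure (K (\<theta> u \<omega>) x) B * w (x + u) \<partial>\<Phi> (\<theta> u \<omega>))
          = (\<integral>\<^sup>+x. emeasure (K (\<theta> u \<omega>) (x - u)) B * w (x - u + u) \<partial>\<Phi> \<omega>)"
        by (rule nn_integral_invariant_measure[OF fl rm inv w])
           (use stationary_flow_space[OF fl w] in measurable)
      then show "(\<integral>\<^sup>+x. emeasure (K (\<theta> u \<omega>) x) B * w (x + u) \<partial>\<Phi> (\<theta> u \<omega>))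
          = (\<integral>\<^sup>+x. emeasure (K \<omega> x) (translate u B) * w x \<partial>\<Phi> \<omega>)"
        by (simp add: invariant_prob_kernel_shift[OF fl K w B])
    qed
    finally show "(\<integral>\<^sup>+\<omega>. \<integral>\<^sup>+x. emeasure (K \<omega> x) B * w (x + u) \<partial>\<Phi> \<omega> \<partial>M)
        = (\<integral>\<^sup>+\<omega>. \<integral>\<^sup>+x. emeasure (K \<omega> x) (translate u B) * w x \<partial>\<Phi> \<omega> \<partial>M)" .
  qed
  also have "\<dots> = (\<integral>\<^sup>+\<omega>. \<integral>\<^sup>+x. \<integral>\<^sup>+u. emeasure (K \<omega> x) (translate u B) * w x \<partial>lborel \<partial>\<Phi> \<omega> \<partial>M)"
    by (rule nn_integral_random_measure_lborel_swap[OF pr rm, symmetric]) (simp add: split_beta')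
  also have "\<dots> = (\<integral>\<^sup>+\<omega>. emeasure lborel B * emeasure (\<Phi> \<omega>) (cbox 0 One) \<partial>M)"
  proof (rule nn_integral_cong)
    fix \<omega> assume w: "\<omega> \<in> space M"
    \<comment> \<open>Now \<open>u\<close> occurs only in the translate of \<open>B\<close>, and
      integrating over it gives the volume of \<open>B\<close> for every starting point
      \<open>x\<close>.\<close>
    have "(\<integral>\<^sup>+u. emeasure (K \<omega> x) (translate u B) * w x \<partial>lborel) = emeasure lborel B * w x" for x
      by (subst nn_integral_multc)
         (use w in \<open>auto simp: nn_integral_kernel_translate[OF invariant_prob_kernel_prob_space(1,2)[OF K w] B]\<close>)
    then show "(\<integral>\<^sup>+x. \<integral>\<^sup>+u. emeasure (K \<omega> x) (translate u B) * w x \<partial>lborel \<partial>\<Phi> \<omega>) = emeasure lborel B * emeasure (\<Phi> \<omega>) (cbox 0 One)"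
      using random_measure_sets[OF rm w] by (simp add: w_def nn_integral_cmult_indicator)
  qed
  also have "\<dots> = emeasure lborel B * intensity M \<Phi>"
    unfolding intensity_def using rm by (intro nn_integral_cmult) (simp add: random_measure_def)
  finally show ?thesis by (simp add: mult.commute)
qed

section \<open>Second moments and the two-point Palm measures\<close>

text \<open>The set covariance of \<open>B\<close>, which depends on the pair only through its
  difference. Both arguments are kept so that it can be integrated directly against measures on
  pairs.\<close>

definition overlap :: "'a::euclidean_space set \<Rightarrow> 'a \<times> 'a \<Rightarrow> ennreal" where
  "overlap B p = (\<integral>\<^sup>+x. indicator B (fst p + x) * indicator B (snd p + x) \<partial>lborel)"

lemma measurable_overlap [measurable]:
  assumes [measurable]: "B \<in> sets borel"
  shows "overlap B \<in> borel_measurable (borel \<Otimes>\<^sub>M borel)"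
  unfolding overlap_def[abs_def] by measurable

lemma overlap_le:
  assumes [measurable]: "B \<in> sets borel"
  shows "overlap B p \<le> emeasure lborel B"
proof -
  have "overlap B p \<le> (\<integral>\<^sup>+x. indicator B (fst p + x) \<partial>lborel)"
    unfolding overlap_def by (intro nn_integral_mono) (auto simp: indicator_def)
  also have "\<dots> = emeasure lborel B" by (subst nn_integral_lborel_translate) auto
  finally show ?thesis .
qed

text \<open>The expectation \<open>E\<^sub>0\<^sub>,\<^sub>y [K\<^sub>y \<otimes> K\<^sub>0]\<close> from the definition of \<open>kappa\<close>.\<close>

definition palm_pair :: "('a::euclidean_space \<Rightarrow> 'w measure) \<Rightarrow> ('w \<Rightarrow> 'a \<Rightarrow> 'a measure) \<Rightarrow> 'a \<Rightarrow> ('a \<times> 'a) measure" where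
  "palm_pair Q K y = Q y \<bind> (\<lambda>\<omega>. K \<omega> y \<Otimes>\<^sub>M K \<omega> 0)"

section \<open>Palm measures and the reduced second moment measure\<close>

lemma two_point_palm_measurable:
  "two_point_palm M \<theta> \<Phi> Q \<Longrightarrow> Q \<in> borel \<rightarrow>\<^sub>M prob_algebra M"
  by (simp add: two_point_palm_def)

lemma two_point_palm_prob_space:
  assumes "two_point_palm M \<theta> \<Phi> Q"
  shows "prob_space (Q y)" "sets (Q y) = sets M" "space (Q y) = space M"
proof -
  have "Q y \<in> space (prob_algebra M)"
    using measurable_space[OF two_point_palm_measurable[OF assms], of y] by simp
  then show "prob_space (Q y)" "sets (Q y) = sets M" "space (Q y) = space M"
    by (auto simp: space_prob_algebra dest: sets_eq_imp_space_eq)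
qed

lemma sets_reduced_second_moment [simp, measurable_cong]:
  "sets (reduced_second_moment M \<Phi>) = sets borel"
  unfolding reduced_second_moment_def using sets.sigma_sets_eq[of borel] by (simp add: sets_measure_of)

lemma space_reduced_second_moment [simp]: "space (reduced_second_moment M \<Phi>) = UNIV"
  using sets_eq_imp_space_eq[OF sets_reduced_second_moment] by simp

text \<open>\<open>measure_of\<close> returns the prescribed set function only if that is countably
  additive. The Palm formula replaces this check: for the indicator of the cube times
  \<open>A\<close>, its left side is the prescribed expression, and its right side is the value of
  the measure, since each \<open>Q y\<close> and the cube have mass 1.\<close>

lemma emeasure_reduced_second_moment:
  fixes \<Phi> :: "'w \<Rightarrow> 'a::euclidean_space measure"
  assumes palm: "two_point_palm M \<theta> \<Phi> Q" and A[measurable]: "A \<in> sets borel"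
  shows "emeasure (reduced_second_moment M \<Phi>) A = (\<integral>\<^sup>+\<omega>. (\<integral>\<^sup>+(x, y). indicator (cbox 0 One) x * indicator A (y - x)
                 \<partial>(\<Phi> \<omega> \<Otimes>\<^sub>M \<Phi> \<omega>)) \<partial>M)"
proof -
  define f where "f = (\<lambda>(x :: 'a, y, \<omega> :: 'w). indicator (cbox 0 One) x * indicator A y :: ennreal)"
  have "f \<in> borel_measurable (borel \<Otimes>\<^sub>M borel \<Otimes>\<^sub>M M)" unfolding f_def by measurable
  then have "(\<integral>\<^sup>+\<omega>. (\<integral>\<^sup>+(x, y). f (x, y - x, \<theta> x \<omega>) \<partial>(\<Phi> \<omega> \<Otimes>\<^sub>M \<Phi> \<omega>)) \<partial>M) =
        (\<integral>\<^sup>+x. (\<integral>\<^sup>+y. (\<integral>\<^sup>+\<omega>. f (x, y, \<omega>) \<partial>Q y) \<partial>reduced_second_moment M \<Phi>) \<partial>lborel)"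
    using palm by (simp only: two_point_palm_def)
  also have "\<dots> = (\<integral>\<^sup>+x. emeasure (reduced_second_moment M \<Phi>) A * indicator (cbox (0::'a) One) x \<partial>lborel)"
  proof (rule nn_integral_cong)
    fix x :: 'a
    have "(\<integral>\<^sup>+\<omega>. f (x, y, \<omega>) \<partial>Q y) = indicator (cbox 0 One) x * indicator A y" for y
      using prob_space.emeasure_space_1[OF two_point_palm_prob_space(1)[OF palm]] by (simp add: f_def)
    then show "(\<integral>\<^sup>+y. (\<integral>\<^sup>+\<omega>. f (x, y, \<omega>) \<partial>Q y) \<partial>reduced_second_moment M \<Phi>)
        = emeasure (reduced_second_moment M \<Phi>) A * indicator (cbox 0 One) x"
      by (simp add: nn_integral_cmult_indicator mult.commute[of "emeasure _ _"])
  qed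
  also have "\<dots> = emeasure (reduced_second_moment M \<Phi>) A"
    by (subst nn_integral_cmult_indicator) (auto simp: emeasure_lborel_cbox)
  finally show ?thesis by (simp add: f_def)
qed

lemma nn_integral_random_measure_times:
  fixes \<Phi> :: "'w \<Rightarrow> 'a::euclidean_space measure"
  assumes rm: "random_measure M \<Phi>" and w: "\<omega> \<in> space M"
    and f[measurable]: "f \<in> borel_measurable borel" and g[measurable]: "g \<in> borel_measurable borel"
  shows "(\<integral>\<^sup>+(x, y). f x * g y \<partial>(\<Phi> \<omega> \<Otimes>\<^sub>M \<Phi> \<omega>)) = (\<integral>\<^sup>+x. f x \<partial>\<Phi> \<omega>) * (\<integral>\<^sup>+x. g x \<partial>\<Phi> \<omega>)"
proof -
  interpret sigma_finite_measure "\<Phi> \<omega>" by (rule random_measure_sigma_finite[OF rm w])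
  note [measurable_cong] = random_measure_sets[OF rm w]
  have "(\<integral>\<^sup>+(x, y). f x * g y \<partial>(\<Phi> \<omega> \<Otimes>\<^sub>M \<Phi> \<omega>)) = (\<integral>\<^sup>+x. \<integral>\<^sup>+y. f x * g y \<partial>\<Phi> \<omega> \<partial>\<Phi> \<omega>)"
    by (subst nn_integral_fst[symmetric]) auto
  also have "\<dots> = (\<integral>\<^sup>+x. f x * (\<integral>\<^sup>+y. g y \<partial>\<Phi> \<omega>) \<partial>\<Phi> \<omega>)"
    by (intro nn_integral_cong nn_integral_cmult) measurable
  also have "\<dots> = (\<integral>\<^sup>+x. f x \<partial>\<Phi> \<omega>) * (\<integral>\<^sup>+x. g x \<partial>\<Phi> \<omega>)"
    by (intro nn_integral_multc) measurable
  finally show ?thesis .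
qed

lemma reduced_second_moment_sigma_finite:
  fixes \<Phi> :: "'w \<Rightarrow> 'a::euclidean_space measure"
  assumes rm: "random_measure M \<Phi>" and lsi: "locally_square_integrable M \<Phi>"
    and palm: "two_point_palm M \<theta> \<Phi> Q"
  shows "sigma_finite_measure (reduced_second_moment M \<Phi>)"
proof
  let ?\<alpha> = "reduced_second_moment M \<Phi>"
  obtain R where R: "cbox (0::'a) One \<subseteq> ball 0 R"
    using bounded_subset_ballD[OF bounded_cbox] by blast
  have fin: "emeasure ?\<alpha> (ball 0 (real n)) < \<infinity>" for n :: nat
  proof -
    \<comment> \<open>A point \<open>x\<close> of the cube has norm below \<open>R\<close>, and
      \<open>y\<close> is within distance \<open>n\<close> of it. The ball therefore contains both,
      and the second moment of \<Phi> on it bounds the mass under \<alpha>.\<close>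
    let ?C = "ball (0::'a) (R + real n)"
    have le: "indicator (cbox 0 One) x * indicator (ball 0 (real n)) (y - x) \<le> (indicator ?C x * indicator ?C y :: ennreal)" for x y :: 'a
    proof -
      have "x \<in> ?C \<and> y \<in> ?C" if "x \<in> cbox 0 One" "norm (y - x) < real n"
      proof -
        have "norm x < R" using R that(1) by (auto simp: dist_norm)
        moreover have "norm y \<le> norm x + norm (y - x)" by (rule norm_triangle_sub)
        ultimately show ?thesis using that(2) by simp
      qed
      then show ?thesis by (auto simp: indicator_def)
    qed
    have "emeasure ?\<alpha> (ball 0 (real n)) = (\<integral>\<^sup>+\<omega>. (\<integral>\<^sup>+(x, y). indicator (cbox 0 One) x * indicator (ball 0 (real n)) (y - x)
                 \<partial>(\<Phi> \<omega> \<Otimes>\<^sub>M \<Phi> \<omega>)) \<partial>M)"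
      by (rule emeasure_reduced_second_moment[OF palm]) simp
    also have "\<dots> \<le> (\<integral>\<^sup>+\<omega>. (\<integral>\<^sup>+(x, y). indicator ?C x * indicator ?C y \<partial>(\<Phi> \<omega> \<Otimes>\<^sub>M \<Phi> \<omega>)) \<partial>M)"
      using le by (intro nn_integral_mono) (auto simp: split_beta')
    also have "\<dots> = (\<integral>\<^sup>+\<omega>. (emeasure (\<Phi> \<omega>) ?C)\<^sup>2 \<partial>M)"
      by (intro nn_integral_cong, subst nn_integral_random_measure_times[OF rm])
         (auto simp: power2_eq_square random_measure_sets[OF rm] intro!: borel_measurable_indicator)
    also have "\<dots> < \<infinity>" using lsi by (simp add: locally_square_integrable_def)
    finally show ?thesis .
  qed
  have U: "(\<Union>n::nat. ball (0::'a) (real n)) = UNIV"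
    by (auto simp: dist_norm intro: reals_Archimedean2)
  show "\<exists>A. countable A \<and> A \<subseteq> sets ?\<alpha> \<and> \<Union> A = space ?\<alpha> \<and> (\<forall>a\<in>A. emeasure ?\<alpha> a \<noteq> \<infinity>)"
    using U fin by (intro exI[of _ "range (\<lambda>n. ball 0 (real n))"]) (auto simp: less_top[symmetric])
qed

lemma palm_pair_kernel:
  assumes palm: "two_point_palm M \<theta> \<Phi> Q" and K: "invariant_prob_kernel M \<theta> K"
  shows "palm_pair Q K \<in> borel \<rightarrow>\<^sub>M prob_algebra (borel \<Otimes>\<^sub>M borel)"
proof -
  have "(\<lambda>y. Q y \<bind> (\<lambda>\<omega>. K \<omega> y \<Otimes>\<^sub>M K \<omega> 0)) \<in> borel \<rightarrow>\<^sub>M prob_algebra (borel \<Otimes>\<^sub>M borel)"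
  proof (rule measurable_bind_prob_space2[OF two_point_palm_measurable[OF palm]])
    show "(\<lambda>(y, \<omega>). K \<omega> y \<Otimes>\<^sub>M K \<omega> 0) \<in> borel \<Otimes>\<^sub>M M \<rightarrow>\<^sub>M prob_algebra (borel \<Otimes>\<^sub>M borel)"
      unfolding split_beta'
      by (intro measurable_pair_prob invariant_prob_kernel_measurable_compose[OF K]) auto
  qed
  then show ?thesis by (simp add: palm_pair_def[abs_def])
qed

lemma palm_pair_prob_space:
  assumes "two_point_palm M \<theta> \<Phi> Q" "invariant_prob_kernel M \<theta> K"
  shows "prob_space (palm_pair Q K y)" "sets (palm_pair Q K y) = sets (borel \<Otimes>\<^sub>M borel)"
    "space (palm_pair Q K y) = UNIV"
proof -
  have "palm_pair Q K y \<in> space (prob_algebra (borel \<Otimes>\<^sub>M borel))"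
    using measurable_space[OF palm_pair_kernel[OF assms], of y] by simp
  then show "prob_space (palm_pair Q K y)" "sets (palm_pair Q K y) = sets (borel \<Otimes>\<^sub>M borel)"
    "space (palm_pair Q K y) = UNIV"
    by (auto simp: space_prob_algebra space_pair_measure dest: sets_eq_imp_space_eq)
qed

lemma pair_kernel_measurable:
  assumes palm: "two_point_palm M \<theta> \<Phi> Q" and K: "invariant_prob_kernel M \<theta> K"
  shows "(\<lambda>\<omega>. K \<omega> y \<Otimes>\<^sub>M K \<omega> 0) \<in> Q y \<rightarrow>\<^sub>M prob_algebra (borel \<Otimes>\<^sub>M borel)"
proof -
  have "(\<lambda>\<omega>. K \<omega> y \<Otimes>\<^sub>M K \<omega> 0) \<in> M \<rightarrow>\<^sub>M prob_algebra (borel \<Otimes>\<^sub>M borel)"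
    by (intro measurable_pair_prob invariant_prob_kernel_measurable_compose[OF K]) auto
  then show ?thesis using two_point_palm_prob_space(2)[OF palm] by (simp cong: measurable_cong_sets)
qed

lemma nn_integral_palm_pair:
  assumes palm: "two_point_palm M \<theta> \<Phi> Q" and K: "invariant_prob_kernel M \<theta> K"
    and f: "f \<in> borel_measurable (borel \<Otimes>\<^sub>M borel)"
  shows "(\<integral>\<^sup>+p. f p \<partial>palm_pair Q K y) = (\<integral>\<^sup>+\<omega>. \<integral>\<^sup>+p. f p \<partial>(K \<omega> y \<Otimes>\<^sub>M K \<omega> 0) \<partial>Q y)"
  unfolding palm_pair_def
  by (rule nn_integral_bind[OF f measurable_prob_algebraD[OF pair_kernel_measurable[OF palm K]]])

text \<open>Once Fubini has brought \<open>x\<close> outside, the product measure factorises into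
  the two masses of the translated set. The factors stand in the order in which the second-moment
  computation produces them.\<close>

lemma nn_integral_kernel_pair_overlap:
  fixes \<mu> \<nu> :: "'a::euclidean_space measure"
  assumes "prob_space \<mu>" "prob_space \<nu>" and s: "sets \<mu> = sets borel" "sets \<nu> = sets borel" and B[measurable]: "B \<in> sets borel"
  shows "(\<integral>\<^sup>+p. overlap B p \<partial>(\<mu> \<Otimes>\<^sub>M \<nu>)) = (\<integral>\<^sup>+x. emeasure \<nu> (translate (- x) B) * emeasure \<mu> (translate (- x) B) \<partial>lborel)"
proof -
  interpret m: prob_space \<mu> by fact
  interpret n: prob_space \<nu> by fact
  interpret mn: prob_space "\<mu> \<Otimes>\<^sub>M \<nu>" using assms(1,2) by (rule prob_space_pair)
  interpret P: pair_sigma_finite "lborel :: 'a measure" "\<mu> \<Otimes>\<^sub>M \<nu>" ..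
  note [measurable_cong] = s
  have e: "(\<integral>\<^sup>+u. indicator B (u + x) \<partial>\<rho>) = emeasure \<rho> (translate (- x) B)"
    if "sets \<rho> = sets borel" for \<rho> and x :: 'a
  proof -
    have "(\<integral>\<^sup>+u. indicator B (u + x) \<partial>\<rho>) = (\<integral>\<^sup>+u. indicator (translate (- x) B) u \<partial>\<rho>)"
      by (intro nn_integral_cong) (simp add: translate_eq_vimage indicator_def)
    then show ?thesis using that sets_translate[OF B] by simp
  qed
  have "(\<integral>\<^sup>+p. overlap B p \<partial>(\<mu> \<Otimes>\<^sub>M \<nu>)) = (\<integral>\<^sup>+x. \<integral>\<^sup>+p. indicator B (fst p + x) * indicator B (snd p + x) \<partial>(\<mu> \<Otimes>\<^sub>M \<nu>) \<partial>lborel)"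
    unfolding overlap_def by (rule P.Fubini') measurable
  also have "\<dots> = (\<integral>\<^sup>+x. emeasure \<nu> (translate (- x) B) * emeasure \<mu> (translate (- x) B) \<partial>lborel)"
  proof (rule nn_integral_cong)
    fix x :: 'a
    have "(\<integral>\<^sup>+p. indicator B (fst p + x) * indicator B (snd p + x) \<partial>(\<mu> \<Otimes>\<^sub>M \<nu>))
        = (\<integral>\<^sup>+u. \<integral>\<^sup>+v. indicator B (u + x) * indicator B (v + x) \<partial>\<nu> \<partial>\<mu>)"
      by (subst n.nn_integral_fst[symmetric]) auto
    also have "\<dots> = (\<integral>\<^sup>+u. indicator B (u + x) * (\<integral>\<^sup>+v. indicator B (v + x) \<partial>\<nu>) \<partial>\<mu>)"
      by (intro nn_integral_cong nn_integral_cmult) measurable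
    also have "\<dots> = (\<integral>\<^sup>+u. indicator B (u + x) \<partial>\<mu>) * (\<integral>\<^sup>+v. indicator B (v + x) \<partial>\<nu>)"
      by (intro nn_integral_multc) measurable
    finally show "(\<integral>\<^sup>+p. indicator B (fst p + x) * indicator B (snd p + x) \<partial>(\<mu> \<Otimes>\<^sub>M \<nu>))
        = emeasure \<nu> (translate (- x) B) * emeasure \<mu> (translate (- x) B)"
      by (simp add: e s mult.commute)
  qed
  finally show ?thesis .
qed

lemma nn_integral_transport_squared:
  fixes \<Phi> :: "'w \<Rightarrow> 'a::euclidean_space measure"
  assumes fl: "stationary_flow M \<theta>" and rm: "random_measure M \<Phi>"
    and lsi: "locally_square_integrable M \<Phi>"
    and palm: "two_point_palm M \<theta> \<Phi> Q"
    and K: "invariant_prob_kernel M \<theta> K" and B[measurable]: "B \<in> sets borel"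
  shows "(\<integral>\<^sup>+\<omega>. (emeasure (transport K \<Phi> \<omega>) B)\<^sup>2 \<partial>M)
    = (\<integral>\<^sup>+y. \<integral>\<^sup>+p. overlap B p \<partial>palm_pair Q K y \<partial>reduced_second_moment M \<Phi>)"
proof -
  let ?\<alpha> = "reduced_second_moment M \<Phi>"
  interpret A: sigma_finite_measure ?\<alpha> by (rule reduced_second_moment_sigma_finite[OF rm lsi palm])
  interpret P: pair_sigma_finite ?\<alpha> "lborel :: 'a measure" ..
  have Km[measurable]: "(\<lambda>p. emeasure (K (f p) (g p)) (translate (h p) B)) \<in> borel_measurable N"
    if "f \<in> N \<rightarrow>\<^sub>M M" "g \<in> N \<rightarrow>\<^sub>M borel" "h \<in> N \<rightarrow>\<^sub>M borel" for f :: "_ \<Rightarrow> 'w" and g h N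
    using measurable_emeasure_kernel[OF K that B] .
  \<comment> \<open>Here \<open>y\<close> is a displacement and \<omega> the configuration seen from
    the first point. In \<open>f (x, y - x, \<theta> x \<omega>)\<close> the translation by
    \<open>- x\<close> undoes the shift of the flow and leaves
    \<open>emeasure (K \<omega> x) B * emeasure (K \<omega> y) B\<close>.\<close>
  define f where "f = (\<lambda>(x, y, \<omega>). emeasure (K \<omega> 0) (translate (- x) B) * emeasure (K \<omega> y) (translate (- x) B))"
  have f: "f \<in> borel_measurable (borel \<Otimes>\<^sub>M borel \<Otimes>\<^sub>M M)"
    unfolding f_def split_beta' by measurable
  have "(\<integral>\<^sup>+\<omega>. (emeasure (transport K \<Phi> \<omega>) B)\<^sup>2 \<partial>M)
      = (\<integral>\<^sup>+\<omega>. (\<integral>\<^sup>+(x, y). f (x, y - x, \<theta> x \<omega>) \<partial>(\<Phi> \<omega> \<Otimes>\<^sub>M \<Phi> \<omega>)) \<partial>M)"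
  proof (rule nn_integral_cong)
    fix \<omega> assume w: "\<omega> \<in> space M"
    have "f (x, y - x, \<theta> x \<omega>) = emeasure (K \<omega> x) B * emeasure (K \<omega> y) B" for x y
      by (simp add: f_def invariant_prob_kernel_shift[OF fl K w sets_translate[OF B]] translate_translate)
         (simp add: translate_eq_vimage)
    moreover have "(\<integral>\<^sup>+(x, y). emeasure (K \<omega> x) B * emeasure (K \<omega> y) B \<partial>(\<Phi> \<omega> \<Otimes>\<^sub>M \<Phi> \<omega>)) = (emeasure (transport K \<Phi> \<omega>) B)\<^sup>2"
      using w by (subst nn_integral_random_measure_times[OF rm w])
        (auto simp: emeasure_transport[OF rm K w B] power2_eq_square intro!: measurable_emeasure_kernel'[OF K _ _ B])
    ultimately show "(emeasure (transport K \<Phi> \<omega>) B)\<^sup>2 = (\<integral>\<^sup>+(x, y). f (x, y - x, \<theta> x \<omega>) \<partial>(\<Phi> \<omega> \<Otimes>\<^sub>M \<Phi> \<omega>))"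
      by simp
  qed
  also have "\<dots> = (\<integral>\<^sup>+x. (\<integral>\<^sup>+y. (\<integral>\<^sup>+\<omega>. f (x, y, \<omega>) \<partial>Q y) \<partial>?\<alpha>) \<partial>lborel)"
    using palm f by (simp only: two_point_palm_def)
  \<comment> \<open>The integral over the position \<open>x\<close> moves inside, where it becomes
    the overlap. Sigma-finiteness of \<alpha> enters through this exchange.\<close>
  also have "\<dots> = (\<integral>\<^sup>+y. (\<integral>\<^sup>+x. (\<integral>\<^sup>+\<omega>. f (x, y, \<omega>) \<partial>Q y) \<partial>lborel) \<partial>?\<alpha>)"
  proof (rule P.Fubini')
    have Q: "(\<lambda>p. Q (fst p)) \<in> ?\<alpha> \<Otimes>\<^sub>M lborel \<rightarrow>\<^sub>M subprob_algebra M"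
      by (rule measurable_compose[OF _ measurable_prob_algebraD[OF two_point_palm_measurable[OF palm]]]) simp
    have "(\<lambda>p. \<integral>\<^sup>+\<omega>. f (snd p, fst p, \<omega>) \<partial>Q (fst p)) \<in> borel_measurable (?\<alpha> \<Otimes>\<^sub>M lborel)"
      by (rule nn_integral_measurable_subprob_algebra2[OF _ Q]) (use f in measurable)
    then show "(\<lambda>(y, x). \<integral>\<^sup>+\<omega>. f (x, y, \<omega>) \<partial>Q y) \<in> borel_measurable (?\<alpha> \<Otimes>\<^sub>M lborel)"
      by (simp add: split_beta')
  qed
  also have "\<dots> = (\<integral>\<^sup>+y. \<integral>\<^sup>+p. overlap B p \<partial>palm_pair Q K y \<partial>?\<alpha>)"
  proof (rule nn_integral_cong)
    fix y :: 'a
    note [measurable_cong] = two_point_palm_prob_space(2)[OF palm]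
    interpret Qy: prob_space "Q y" by (rule two_point_palm_prob_space(1)[OF palm])
    interpret P': pair_sigma_finite "Q y" "lborel :: 'a measure" ..
    have "(\<lambda>p. f (snd p, y, fst p)) \<in> borel_measurable (Q y \<Otimes>\<^sub>M lborel)"
      by (rule measurable_compose[OF _ f]) measurable
    then have "(\<integral>\<^sup>+x. \<integral>\<^sup>+\<omega>. f (x, y, \<omega>) \<partial>Q y \<partial>lborel) = (\<integral>\<^sup>+\<omega>. \<integral>\<^sup>+x. f (x, y, \<omega>) \<partial>lborel \<partial>Q y)"
      by (intro P'.Fubini') (simp add: split_beta')
    also have "\<dots> = (\<integral>\<^sup>+\<omega>. \<integral>\<^sup>+p. overlap B p \<partial>(K \<omega> y \<Otimes>\<^sub>M K \<omega> 0) \<partial>Q y)"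
    proof (rule nn_integral_cong)
      fix \<omega> assume "\<omega> \<in> space (Q y)"
      then have w: "\<omega> \<in> space M" using two_point_palm_prob_space(3)[OF palm] by simp
      show "(\<integral>\<^sup>+x. f (x, y, \<omega>) \<partial>lborel) = (\<integral>\<^sup>+p. overlap B p \<partial>(K \<omega> y \<Otimes>\<^sub>M K \<omega> 0))"
        using invariant_prob_kernel_prob_space[OF K w]
        by (subst nn_integral_kernel_pair_overlap) (auto simp: f_def)
    qed
    also have "\<dots> = (\<integral>\<^sup>+p. overlap B p \<partial>palm_pair Q K y)"
      by (rule nn_integral_palm_pair[OF palm K measurable_overlap[OF B], symmetric])
    finally show "(\<integral>\<^sup>+x. \<integral>\<^sup>+\<omega>. f (x, y, \<omega>) \<partial>Q y \<partial>lborel) = (\<integral>\<^sup>+p. overlap B p \<partial>palm_pair Q K y)" .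
  qed
  finally show ?thesis .
qed

text \<open>Real-valued, because it is to serve as a test function in \<open>signed_norm\<close>;
  for sets of volume 0 the quotient is 0.\<close>

definition overlap_ratio :: "'a::euclidean_space set \<Rightarrow> 'a \<times> 'a \<Rightarrow> real" where
  "overlap_ratio B p = enn2real (overlap B p) / measure lborel B"

lemma measurable_overlap_ratio [measurable]:
  assumes [measurable]: "B \<in> sets borel"
  shows "overlap_ratio B \<in> borel_measurable (borel \<Otimes>\<^sub>M borel)"
  unfolding overlap_ratio_def[abs_def] by measurable

lemma overlap_ratio_bounds:
  assumes B: "B \<in> sets borel" "bounded B"
  shows "0 \<le> overlap_ratio B p" "overlap_ratio B p \<le> 1"
proof -
  show "0 \<le> overlap_ratio B p" by (simp add: overlap_ratio_def)
  have "enn2real (overlap B p) \<le> measure lborel B"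
    unfolding measure_def using overlap_le[OF B(1)] emeasure_bounded_finite[OF B(2)]
    by (intro enn2real_mono) auto
  then show "overlap_ratio B p \<le> 1"
    by (cases "measure lborel B = 0") (auto simp: overlap_ratio_def divide_le_eq_1 zero_less_measure_iff)
qed

text \<open>Null sets are no exception: there \<open>overlap\<close> vanishes because it is at most
  the volume.\<close>

lemma overlap_eq_ratio:
  assumes B: "B \<in> sets borel" "bounded B"
  shows "overlap B p = ennreal (measure lborel B * overlap_ratio B p)"
proof -
  have fin: "emeasure lborel B < \<infinity>" using emeasure_bounded_finite[OF B(2)] .
  have o: "overlap B p < \<infinity>" using overlap_le[OF B(1), of p] fin by (rule le_less_trans)
  show ?thesis
  proof (cases "measure lborel B = 0")
    case True
    then have "emeasure lborel B = 0"
      using fin by (auto simp: measure_def enn2real_eq_0_iff)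
    then show ?thesis using True overlap_le[OF B(1), of p] by simp
  next
    case False
    then show ?thesis using o by (simp add: overlap_ratio_def)
  qed
qed

text \<open>For bounded Borel \<open>B\<close> of positive volume, its integral over \<alpha> is the
  second moment of the transported mass of \<open>B\<close> divided by the volume.\<close>

definition palm_overlap ::
  "('a::euclidean_space \<Rightarrow> 'w measure) \<Rightarrow> ('w \<Rightarrow> 'a \<Rightarrow> 'a measure) \<Rightarrow> 'a set \<Rightarrow> 'a \<Rightarrow> real" where
  "palm_overlap Q K B y = (\<integral>p. overlap_ratio B p \<partial>palm_pair Q K y)"

section \<open>Normalised overlaps and \<open>kappa\<close>\<close>

context
  fixes M :: "'w measure" and \<theta> :: "'a::euclidean_space \<Rightarrow> 'w \<Rightarrow> 'w" and \<Phi> :: "'w \<Rightarrow> 'a measure" and Q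
  assumes palm: "two_point_palm M \<theta> \<Phi> Q"
begin

lemma integrable_overlap_ratio:
  assumes K: "invariant_prob_kernel M \<theta> K" and B: "B \<in> sets borel" "bounded B"
  shows "integrable (palm_pair Q K y) (overlap_ratio B)"
proof -
  interpret prob_space "palm_pair Q K y" by (rule palm_pair_prob_space(1)[OF palm K])
  show ?thesis
    using overlap_ratio_bounds[OF B] measurable_overlap_ratio[OF B(1)]
    by (intro integrable_const_bound[of _ 1]) (auto simp: measurable_cong_sets[OF palm_pair_prob_space(2)[OF palm K] refl])
qed

lemma palm_overlap_nonneg:
  assumes B: "B \<in> sets borel" "bounded B"
  shows "0 \<le> palm_overlap Q K B y"
  unfolding palm_overlap_def using overlap_ratio_bounds[OF B] by (intro integral_nonneg_AE) auto

lemma nn_integral_overlap_palm_pair: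
  assumes K: "invariant_prob_kernel M \<theta> K" and B: "B \<in> sets borel" "bounded B"
  shows "(\<integral>\<^sup>+p. overlap B p \<partial>palm_pair Q K y) = ennreal (measure lborel B * palm_overlap Q K B y)"
proof -
  have "(\<integral>\<^sup>+p. overlap B p \<partial>palm_pair Q K y) = (\<integral>\<^sup>+p. ennreal (measure lborel B * overlap_ratio B p) \<partial>palm_pair Q K y)"
    by (simp add: overlap_eq_ratio[OF B])
  also have "\<dots> = ennreal (\<integral>p. measure lborel B * overlap_ratio B p \<partial>palm_pair Q K y)"
    using integrable_overlap_ratio[OF K B] overlap_ratio_bounds[OF B]
    by (intro nn_integral_eq_integral) auto
  finally show ?thesis by (simp add: palm_overlap_def)
qed

lemma measurable_palm_overlap:
  assumes K: "invariant_prob_kernel M \<theta> K" and B: "B \<in> sets borel" "bounded B"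
  shows "palm_overlap Q K B \<in> borel_measurable borel"
proof -
  note [measurable] = measurable_overlap_ratio[OF B(1)]
  have "(\<lambda>y. \<integral>\<^sup>+p. ennreal (overlap_ratio B p) \<partial>palm_pair Q K y) \<in> borel_measurable borel"
    by (rule nn_integral_measurable_subprob_algebra2[OF _ measurable_prob_algebraD[OF palm_pair_kernel[OF palm K]]])
       measurable
  moreover have "palm_overlap Q K B = (\<lambda>y. enn2real (\<integral>\<^sup>+p. ennreal (overlap_ratio B p) \<partial>palm_pair Q K y))"
    unfolding palm_overlap_def
    using integrable_overlap_ratio[OF K B] overlap_ratio_bounds[OF B]
    by (intro ext integral_eq_nn_integral) auto
  ultimately show ?thesis by simp
qed

lemma nn_integral_palm_overlap:
  assumes fl: "stationary_flow M \<theta>" and rm: "random_measure M \<Phi>"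
    and lsi: "locally_square_integrable M \<Phi>"
    and K: "invariant_prob_kernel M \<theta> K" and B: "B \<in> sets borel" "bounded B"
  shows "(\<integral>\<^sup>+\<omega>. (emeasure (transport K \<Phi> \<omega>) B)\<^sup>2 \<partial>M)
    = ennreal (measure lborel B) * (\<integral>\<^sup>+y. ennreal (palm_overlap Q K B y) \<partial>reduced_second_moment M \<Phi>)"
proof -
  have "(\<integral>\<^sup>+\<omega>. (emeasure (transport K \<Phi> \<omega>) B)\<^sup>2 \<partial>M)
      = (\<integral>\<^sup>+y. ennreal (measure lborel B * palm_overlap Q K B y) \<partial>reduced_second_moment M \<Phi>)"
    by (simp add: nn_integral_transport_squared[OF fl rm lsi palm K B(1)] nn_integral_overlap_palm_pair[OF K B])
  also have "\<dots> = ennreal (measure lborel B) * (\<integral>\<^sup>+y. ennreal (palm_overlap Q K B y) \<partial>reduced_second_moment M \<Phi>)"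
    using palm_overlap_nonneg[OF B] measurable_palm_overlap[OF K B]
    by (subst nn_integral_cmult[symmetric]) (auto simp: ennreal_mult cong: measurable_cong_sets)
  finally show ?thesis .
qed

text \<open>The set function inside \<open>kappa\<close> is a difference of two probability
  measures, because the expectation in \<open>palm_pair\<close> can be taken setwise. Its signed
  integral is therefore a difference of ordinary integrals, and \<open>f\<close> competes in the
  supremum.\<close>

lemma kappa_bound:
  assumes K: "invariant_prob_kernel M \<theta> K" and L: "invariant_prob_kernel M \<theta> L"
    and f: "f \<in> borel_measurable (borel \<Otimes>\<^sub>M borel)" and bd: "\<And>p. f p \<in> {-1..1}"
  shows "\<bar>(\<integral>p. f p \<partial>palm_pair Q K y) - (\<integral>p. f p \<partial>palm_pair Q L y)\<bar> \<le> kappa Q K L y"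
proof -
  let ?N = "borel \<Otimes>\<^sub>M borel :: ('a \<times> 'a) measure"
  define \<nu> where "\<nu> = (\<lambda>C. \<integral>\<omega>. (measure (K \<omega> y \<Otimes>\<^sub>M K \<omega> 0) C - measure (L \<omega> y \<Otimes>\<^sub>M L \<omega> 0) C) \<partial>Q y)"
  interpret Qy: prob_space "Q y" by (rule two_point_palm_prob_space(1)[OF palm])
  have int: "integrable (Q y) (\<lambda>\<omega>. measure (K \<omega> y \<Otimes>\<^sub>M K \<omega> 0) C)"
    and ms: "measure (palm_pair Q K y) C = (\<integral>\<omega>. measure (K \<omega> y \<Otimes>\<^sub>M K \<omega> 0) C \<partial>Q y)"
    if K: "invariant_prob_kernel M \<theta> K" and C: "C \<in> sets ?N" for K C
  proof -
    note k = pair_kernel_measurable[OF palm K, of y]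
    show "measure (palm_pair Q K y) C = (\<integral>\<omega>. measure (K \<omega> y \<Otimes>\<^sub>M K \<omega> 0) C \<partial>Q y)"
      unfolding palm_pair_def by (rule Qy.measure_bind[OF measurable_prob_algebraD[OF k] C])
    have p: "prob_space (K \<omega> y \<Otimes>\<^sub>M K \<omega> 0)" if "\<omega> \<in> space (Q y)" for \<omega>
      using measurable_space[OF k that] by (simp add: space_prob_algebra)
    show "integrable (Q y) (\<lambda>\<omega>. measure (K \<omega> y \<Otimes>\<^sub>M K \<omega> 0) C)"
      using p measurable_compose[OF k measurable_measure_prob_algebra[OF C]]
      by (intro Qy.integrable_const_bound[of _ 1]) (auto intro!: AE_I2 prob_space.prob_le_1)
  qed
  have \<nu>: "\<nu> C = measure (palm_pair Q K y) C - measure (palm_pair Q L y) C" if "C \<in> sets ?N" for C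
    unfolding \<nu>_def ms[OF K that] ms[OF L that] by (rule Bochner_Integration.integral_diff[OF int[OF K that] int[OF L that]])
  note pK = palm_pair_prob_space[OF palm K, of y]
  note pL = palm_pair_prob_space[OF palm L, of y]
  interpret PK: prob_space "palm_pair Q K y" by (rule pK)
  interpret PL: prob_space "palm_pair Q L y" by (rule pL)
  have eq: "signed_integral ?N \<nu> g = (\<integral>p. g p \<partial>palm_pair Q K y) - (\<integral>p. g p \<partial>palm_pair Q L y)"
    if "g \<in> borel_measurable ?N" "\<And>p. g p \<in> {-1..1}" for g
  proof (rule signed_integral_eq[OF PK.finite_measure_axioms PL.finite_measure_axioms pK(2) pL(2) \<nu> that(1)])
    show "\<bar>g p\<bar> \<le> 1" for p using that(2)[of p] by auto
  qed
  have le1: "\<bar>\<integral>p. g p \<partial>m\<bar> \<le> 1" if "prob_space m" "sets m = sets ?N" "g \<in> borel_measurable ?N" "\<And>p. g p \<in> {-1..1}"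
    for m and g :: "'a \<times> 'a \<Rightarrow> real"
  proof -
    interpret m: prob_space m by fact
    have g: "\<bar>g p\<bar> \<le> 1" for p using that(4)[of p] by auto
    have "integrable m g"
      using that(3) g by (intro m.integrable_const_bound[of _ 1]) (auto simp: measurable_cong_sets[OF that(2) refl])
    then have "\<bar>\<integral>p. g p \<partial>m\<bar> \<le> (\<integral>p. 1 \<partial>m)"
      using g by (intro order_trans[OF integral_abs_bound] integral_mono) auto
    then show ?thesis by (simp add: m.prob_space)
  qed
  have "\<bar>signed_integral ?N \<nu> f\<bar> \<le> signed_norm ?N \<nu>"
    unfolding signed_norm_def
  proof (rule cSUP_upper)
    show "f \<in> {f \<in> borel_measurable ?N. \<forall>x. f x \<in> {-1..1}}" using f bd by auto
    \<comment> \<open>A real supremum dominates its members only for a bounded family. The bound 2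
      comes from two integrals of modulus at most 1.\<close>
    show "bdd_above ((\<lambda>f. \<bar>signed_integral ?N \<nu> f\<bar>) ` {f \<in> borel_measurable ?N. \<forall>x. f x \<in> {-1..1}})"
    proof (rule bdd_aboveI2)
      fix g assume g: "g \<in> {f \<in> borel_measurable ?N. \<forall>x. f x \<in> {-1..1 :: real}}"
      then show "\<bar>signed_integral ?N \<nu> g\<bar> \<le> 2"
        using eq[of g] le1[OF pK(1,2), of g] le1[OF pL(1,2), of g] by auto
    qed
  qed
  then show ?thesis
    unfolding eq[OF f bd] by (simp add: kappa_def \<nu>_def)
qed

text \<open>The right side does not depend on \<open>B\<close>, so a single function dominates the
  differences for all windows.\<close>

lemma palm_overlap_diff_le_kappa:
  assumes "invariant_prob_kernel M \<theta> K" "invariant_prob_kernel M \<theta> L" "B \<in> sets borel" "bounded B"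
  shows "\<bar>palm_overlap Q K B y - palm_overlap Q L B y\<bar> \<le> kappa Q K L y"
proof -
  have "overlap_ratio B p \<in> {-1..1}" for p
    using overlap_ratio_bounds[OF assms(3,4), of p] by simp
  then show ?thesis
    unfolding palm_overlap_def by (rule kappa_bound[OF assms(1,2) measurable_overlap_ratio[OF assms(3)]])
qed

end

section \<open>Growing windows\<close>

lemma nn_integral_lborel_scale:
  fixes f :: "'a::euclidean_space \<Rightarrow> ennreal"
  assumes [measurable]: "f \<in> borel_measurable borel" and c: "c \<noteq> 0"
  shows "(\<integral>\<^sup>+x. f x \<partial>lborel) = ennreal (\<bar>c\<bar> ^ DIM('a)) * (\<integral>\<^sup>+x. f (c *\<^sub>R x) \<partial>lborel)"
proof -
  have "(\<integral>\<^sup>+x. f x \<partial>lborel) = (\<integral>\<^sup>+x. f x \<partial>density (distr lborel borel (\<lambda>x. 0 + c *\<^sub>R x)) (\<lambda>_. ennreal (\<bar>c\<bar> ^ DIM('a))))"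
    by (subst lborel_affine[OF c, of 0]) simp
  also have "\<dots> = ennreal (\<bar>c\<bar> ^ DIM('a)) * (\<integral>\<^sup>+x. f (c *\<^sub>R x) \<partial>lborel)"
    by (simp add: nn_integral_density nn_integral_distr nn_integral_cmult)
  finally show ?thesis .
qed

lemma indicator_scale:
  "r \<noteq> 0 \<Longrightarrow> indicator (scale r W) (r *\<^sub>R x) = indicator W x"
  by (auto simp: scale_def indicator_def)

lemma scale_scale_set: "scale r (scale s W) = scale (r * s) W"
  by (auto simp: scale_def image_image)

lemma scale_eq_vimage: "r \<noteq> 0 \<Longrightarrow> scale r W = (\<lambda>x. x /\<^sub>R r) -` W"
  by (force simp: scale_def image_iff)

lemma sets_scale [measurable]:
  assumes W: "W \<in> sets borel"
  shows "scale r W \<in> sets borel"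
proof (cases "r = 0")
  case True
  then have "scale r W = (if W = {} then {} else {0})" by (auto simp: scale_def)
  then show ?thesis by simp
next
  case False
  have "(\<lambda>x. x /\<^sub>R r) -` W \<inter> space borel \<in> sets borel"
    by (rule measurable_sets[OF _ W]) simp
  then show ?thesis by (simp add: scale_eq_vimage[OF False])
qed

lemma bounded_scale: "bounded W \<Longrightarrow> bounded (scale r W)"
  unfolding scale_def by (rule bounded_scaling)

lemma emeasure_scale:
  fixes W :: "'a::euclidean_space set"
  assumes [measurable]: "W \<in> sets borel" and r: "r \<noteq> 0"
  shows "emeasure lborel (scale r W) = ennreal (\<bar>r\<bar> ^ DIM('a)) * emeasure lborel W"
proof -
  have "emeasure lborel (scale r W) = (\<integral>\<^sup>+x. indicator (scale r W) x \<partial>lborel)" by simp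
  also have "\<dots> = ennreal (\<bar>r\<bar> ^ DIM('a)) * (\<integral>\<^sup>+x. indicator (scale r W) (r *\<^sub>R x) \<partial>lborel)"
    by (rule nn_integral_lborel_scale[OF _ r]) measurable
  also have "\<dots> = ennreal (\<bar>r\<bar> ^ DIM('a)) * emeasure lborel W"
    by (simp only: indicator_scale[OF r]) simp
  finally show ?thesis .
qed

text \<open>Enlarging the window by \<open>r\<close> amounts to shrinking the two points by
  \<open>r\<close>: a growing window becomes a pair tending to 0 in a fixed window.\<close>

lemma overlap_scale:
  fixes W :: "'a::euclidean_space set"
  assumes [measurable]: "W \<in> sets borel" and r: "r \<noteq> 0"
  shows "overlap (scale r W) p = ennreal (\<bar>r\<bar> ^ DIM('a)) * overlap W (p /\<^sub>R r)"
proof -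
  have e: "indicator (scale r W) (a + r *\<^sub>R x) = (indicator W (a /\<^sub>R r + x) :: ennreal)" for a x
    using indicator_scale[OF r, of W "a /\<^sub>R r + x"] r by (simp add: scaleR_add_right)
  show ?thesis
    unfolding overlap_def
    by (subst nn_integral_lborel_scale[OF _ r]) (auto simp: e)
qed

text \<open>Positive volume makes the ratios meaningful, and equality with the volume of the
  interior lets \<open>tendsto_overlap\<close> argue at interior points only.\<close>

lemma convex_window_emeasure:
  fixes W :: "'a::euclidean_space set"
  assumes W: "convex_window W" and [measurable]: "W \<in> sets borel"
  shows "emeasure lborel (interior W) = emeasure lborel W" "0 < measure lborel W"
    "emeasure lborel W = ennreal (measure lborel W)"
proof -
  have "negligible (W - interior W)"
    using W closure_subset[of W] by (intro negligible_subset[OF negligible_convex_frontier[of W]])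
      (auto simp: frontier_def convex_window_def)
  then have "W - interior W \<in> null_sets lborel"
    by (simp add: negligible_iff_null_sets null_sets_completion_iff)
  then have "emeasure lborel (interior W \<union> (W - interior W)) = emeasure lborel (interior W)"
    by (intro emeasure_Un_null_set) auto
  then show i: "emeasure lborel (interior W) = emeasure lborel W"
    using interior_subset[of W] by (simp add: Un_absorb1)
  have fin: "emeasure lborel W < \<infinity>"
    using W by (intro emeasure_bounded_finite) (simp add: convex_window_def)
  then show e: "emeasure lborel W = ennreal (measure lborel W)"
    by (simp add: emeasure_eq_ennreal_measure less_top)
  have "emeasure lborel (interior W) \<noteq> 0"
  proof
    assume "emeasure lborel (interior W) = 0"
    then have "interior W \<in> null_sets lborel" by auto
    then have "negligible (interior W)"
      by (simp add: negligible_iff_null_sets null_sets_completionI)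
    then show False
      using open_not_negligible[of "interior W"] W by (auto simp: convex_window_def)
  qed
  then show "0 < measure lborel W" using i e by (metis ennreal_0 less_eq_real_def measure_nonneg)
qed

lemma tendsto_overlap:
  fixes W :: "'a::euclidean_space set"
  assumes W: "convex_window W" and [measurable]: "W \<in> sets borel" and q: "q \<longlonglongrightarrow> 0"
  shows "(\<lambda>n. overlap W (q n)) \<longlonglongrightarrow> emeasure lborel W"
proof (rule tendsto_sandwich)
  \<comment> \<open>Cutting down to interior points gives a lower bound whose pointwise limit is
    clear: small shifts keep an interior point in \<open>W\<close>, and all other points contribute
    0. The matching upper bound is \<open>overlap_le\<close>.\<close>
  let ?g = "\<lambda>n x. indicator (interior W) x * (indicator W (fst (q n) + x) * indicator W (snd (q n) + x)) :: ennreal"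
  have "(\<lambda>n. \<integral>\<^sup>+x. ?g n x \<partial>lborel) \<longlonglongrightarrow> (\<integral>\<^sup>+x. indicator (interior W) x \<partial>lborel)"
  proof (rule nn_integral_dominated_convergence)
    show "(\<integral>\<^sup>+x. indicator (interior W) x \<partial>lborel) < \<infinity>"
      using convex_window_emeasure[OF W] by simp
    show "AE x in lborel. ?g n x \<le> indicator (interior W) x" for n
      by (auto simp: indicator_def)
    show "AE x in lborel. (\<lambda>n. ?g n x) \<longlonglongrightarrow> indicator (interior W) x"
    proof (rule AE_I2)
      fix x
      show "(\<lambda>n. ?g n x) \<longlonglongrightarrow> indicator (interior W) x"
      proof (cases "x \<in> interior W")
        case True
        have "(\<lambda>n. fst (q n) + x) \<longlonglongrightarrow> x" "(\<lambda>n. snd (q n) + x) \<longlonglongrightarrow> x"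
          using tendsto_add[OF tendsto_fst[OF q] tendsto_const[of x]]
            tendsto_add[OF tendsto_snd[OF q] tendsto_const[of x]] by simp_all
        then have "eventually (\<lambda>n. fst (q n) + x \<in> interior W) sequentially"
          "eventually (\<lambda>n. snd (q n) + x \<in> interior W) sequentially"
          using True by (simp_all add: topological_tendstoD[OF _ open_interior])
        then have "eventually (\<lambda>n. ?g n x = 1) sequentially"
          by eventually_elim (use True interior_subset in \<open>auto simp: indicator_def\<close>)
        then show ?thesis using True by (simp add: tendsto_eventually)
      qed simp
    qed
  qed measurable
  then show "(\<lambda>n. \<integral>\<^sup>+x. ?g n x \<partial>lborel) \<longlonglongrightarrow> emeasure lborel W"
    by (simp add: convex_window_emeasure(1)[OF W])
  show "eventually (\<lambda>n. (\<integral>\<^sup>+x. ?g n x \<partial>lborel) \<le> overlap W (q n)) sequentially"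
    unfolding overlap_def by (intro always_eventually allI nn_integral_mono) (auto simp: indicator_def)
  show "eventually (\<lambda>n. overlap W (q n) \<le> emeasure lborel W) sequentially"
    by (intro always_eventually allI overlap_le) simp
qed simp

lemma tendsto_overlap_ratio:
  fixes W :: "'a::euclidean_space set"
  assumes W: "convex_window W" and Wm: "W \<in> sets borel" and X: "filterlim X at_top sequentially"
  shows "(\<lambda>n. overlap_ratio (scale (X n) W) p) \<longlonglongrightarrow> 1"
proof -
  note e = convex_window_emeasure[OF W Wm]
  have "(\<lambda>n. p /\<^sub>R X n) \<longlonglongrightarrow> 0 *\<^sub>R p"
    by (rule tendsto_scaleR[OF tendsto_inverse_0_at_top[OF X] tendsto_const])
  then have "(\<lambda>n. overlap W (p /\<^sub>R X n)) \<longlonglongrightarrow> ennreal (measure lborel W)"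
    using tendsto_overlap[OF W Wm] e(3) by simp
  then have "(\<lambda>n. enn2real (overlap W (p /\<^sub>R X n))) \<longlonglongrightarrow> measure lborel W"
    by (rule tendsto_enn2real) simp
  then have "(\<lambda>n. overlap_ratio W (p /\<^sub>R X n)) \<longlonglongrightarrow> measure lborel W / measure lborel W"
    unfolding overlap_ratio_def using e(2) by (intro tendsto_divide tendsto_const) auto
  then have "(\<lambda>n. overlap_ratio W (p /\<^sub>R X n)) \<longlonglongrightarrow> 1" using e(2) by simp
  \<comment> \<open>Once \<open>X n > 0\<close>, the same power of \<open>X n\<close> scales overlap
    and volume and cancels in the ratio.\<close>
  moreover have "eventually (\<lambda>n. overlap_ratio W (p /\<^sub>R X n) = overlap_ratio (scale (X n) W) p) sequentially"
    using X[unfolded filterlim_at_top_dense, rule_format, of 0]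
  proof eventually_elim
    case (elim n)
    then show ?case
      using overlap_scale[OF Wm, of "X n" p] emeasure_scale[OF Wm, of "X n"]
      by (simp add: overlap_ratio_def measure_def enn2real_mult)
  qed
  ultimately show ?thesis by (rule Lim_transform_eventually)
qed

section \<open>Comparison of variances\<close>

text \<open>A finite second moment makes \<open>Y\<close> finite almost surely, so
  \<open>enn2real\<close>, which sends infinity to 0, changes it on a null set only. This is needed
  for \<open>transport\<close>, whose value on a bounded set may be infinite for some
  \<omega>.\<close>

lemma (in prob_space) variance_enn2real:
  fixes Y :: "'a \<Rightarrow> ennreal"
  assumes Y[measurable]: "Y \<in> borel_measurable M" and fin: "(\<integral>\<^sup>+\<omega>. (Y \<omega>)\<^sup>2 \<partial>M) < \<infinity>"
  shows "variance (\<lambda>\<omega>. enn2real (Y \<omega>)) = enn2real (\<integral>\<^sup>+\<omega>. (Y \<omega>)\<^sup>2 \<partial>M) - (enn2real (\<integral>\<^sup>+\<omega>. Y \<omega> \<partial>M))\<^sup>2"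
proof -
  have "AE \<omega> in M. (Y \<omega>)\<^sup>2 \<noteq> \<infinity>"
    using fin by (intro nn_integral_PInf_AE) auto
  then have Yfin: "AE \<omega> in M. Y \<omega> \<noteq> \<infinity>"
    by eventually_elim (auto simp: power2_eq_square)
  have sq: "(\<integral>\<^sup>+\<omega>. ennreal ((enn2real (Y \<omega>))\<^sup>2) \<partial>M) = (\<integral>\<^sup>+\<omega>. (Y \<omega>)\<^sup>2 \<partial>M)"
    using Yfin
    by (intro nn_integral_cong_AE, elim eventually_mono) (auto simp flip: ennreal_power simp: less_top)
  have lin: "(\<integral>\<^sup>+\<omega>. ennreal (enn2real (Y \<omega>)) \<partial>M) = (\<integral>\<^sup>+\<omega>. Y \<omega> \<partial>M)"
    using Yfin by (intro nn_integral_cong_AE, elim eventually_mono) (auto simp: less_top)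
  have i2: "integrable M (\<lambda>\<omega>. (enn2real (Y \<omega>))\<^sup>2)"
    by (rule integrableI_bounded) (use sq fin in auto)
  have i1: "integrable M (\<lambda>\<omega>. enn2real (Y \<omega>))"
    by (rule square_integrable_imp_integrable[OF _ i2]) measurable
  have "expectation (\<lambda>\<omega>. (enn2real (Y \<omega>))\<^sup>2) = enn2real (\<integral>\<^sup>+\<omega>. (Y \<omega>)\<^sup>2 \<partial>M)"
    by (subst integral_eq_nn_integral) (auto simp: sq)
  moreover have "expectation (\<lambda>\<omega>. enn2real (Y \<omega>)) = enn2real (\<integral>\<^sup>+\<omega>. Y \<omega> \<partial>M)"
    by (subst integral_eq_nn_integral) (auto simp: lin)
  ultimately show ?thesis using variance_eq[OF i1 i2] by simp
qed

text \<open>Since \<open>c\<close> may be infinite, limits cannot be subtracted; instead the real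
  difference, which tends to 0, is added in \<open>ereal\<close>, where addition is continuous as
  long as one limit is finite.\<close>

lemma has_asymptotic_variance_transfer:
  assumes "has_asymptotic_variance M W \<Psi> c" and lsi: "locally_square_integrable M \<Psi>'"
    and diff: "((\<lambda>r. prob_space.variance M (\<lambda>\<omega>. measure (\<Psi>' \<omega>) (scale r W)) / measure lebesgue (scale r W)
      - prob_space.variance M (\<lambda>\<omega>. measure (\<Psi> \<omega>) (scale r W)) / measure lebesgue (scale r W)) \<longlongrightarrow> 0) at_top"
    (is "((\<lambda>r. ?b r - ?a r) \<longlongrightarrow> 0) at_top")
  shows "has_asymptotic_variance M W \<Psi>' c"
proof -
  have "((\<lambda>r. ereal (?a r)) \<longlongrightarrow> c) at_top"
    using assms(1) by (simp add: has_asymptotic_variance_def)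
  moreover have "((\<lambda>r. ereal (?b r - ?a r)) \<longlongrightarrow> ereal 0) at_top"
    using diff by (rule tendsto_ereal)
  ultimately have "((\<lambda>r. ereal (?a r) + ereal (?b r - ?a r)) \<longlongrightarrow> c + ereal 0) at_top"
    by (intro tendsto_add_ereal_general1) auto
  then show ?thesis using lsi by (simp add: has_asymptotic_variance_def)
qed

lemma measure_transport_not_borel:
  assumes rm: "random_measure M \<Phi>" and K: "invariant_prob_kernel M \<theta> K"
    and w: "\<omega> \<in> space M" and B: "B \<notin> sets borel"
  shows "measure (transport K \<Phi> \<omega>) B = 0"
proof -
  have "sets (transport K \<Phi> \<omega>) = sets borel"
    unfolding transport_def
    using random_measure_space[OF rm w] invariant_prob_kernel_prob_space(2)[OF K w] by (intro sets_bind) auto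
  then show ?thesis using B by (intro measure_notin_sets) simp
qed

section \<open>Variances of transported measures\<close>

locale palm_stationary = prob_space M for M :: "'w measure" +
  fixes \<theta> :: "'a::euclidean_space \<Rightarrow> 'w \<Rightarrow> 'w" and \<Phi> :: "'w \<Rightarrow> 'a measure" and Q :: "'a \<Rightarrow> 'w measure"
  assumes flow: "stationary_flow M \<theta>" and rm: "random_measure M \<Phi>"
    and inv: "invariant_measure M \<theta> \<Phi>" and lsi: "locally_square_integrable M \<Phi>"
    and palm: "two_point_palm M \<theta> \<Phi> Q"
begin

abbreviation "\<alpha> \<equiv> reduced_second_moment M \<Phi>"

lemma measurable_palm_overlap':
  assumes "invariant_prob_kernel M \<theta> K" "B \<in> sets borel" "bounded B"
  shows "palm_overlap Q K B \<in> borel_measurable \<alpha>"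
  using measurable_palm_overlap[OF palm assms] by (simp cong: measurable_cong_sets)

text \<open>Square-integrability belongs to \<open>has_asymptotic_variance\<close>, so it has to be
  transferred along with the limit. A general \<open>k\<close> in place of \<open>kappa\<close>
  allows \<open>K\<close> and \<open>L\<close> to be exchanged while the dominating function stays
  the same.\<close>

lemma locally_square_integrable_transport_transfer:
  assumes K: "invariant_prob_kernel M \<theta> K" and L: "invariant_prob_kernel M \<theta> L"
    and bd: "\<And>B y. B \<in> sets borel \<Longrightarrow> bounded B \<Longrightarrow> \<bar>palm_overlap Q K B y - palm_overlap Q L B y\<bar> \<le> k y"
    and k: "(\<integral>\<^sup>+y. ennreal (k y) \<partial>\<alpha>) < \<infinity>"
    and lsi_L: "locally_square_integrable M (transport L \<Phi>)"
  shows "locally_square_integrable M (transport K \<Phi>)"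
  unfolding locally_square_integrable_def
proof (intro ballI impI)
  fix B :: "'a set" assume B: "B \<in> sets borel" "bounded B"
  note [measurable] = measurable_palm_overlap'[OF K B] measurable_palm_overlap'[OF L B]
  let ?V = "ennreal (measure lborel B)"
  have "(\<integral>\<^sup>+y. ennreal \<bar>palm_overlap Q K B y - palm_overlap Q L B y\<bar> \<partial>\<alpha>) \<le> (\<integral>\<^sup>+y. ennreal (k y) \<partial>\<alpha>)"
    using bd[OF B] by (intro nn_integral_mono ennreal_leI) auto
  then have D: "(\<integral>\<^sup>+y. ennreal \<bar>palm_overlap Q K B y - palm_overlap Q L B y\<bar> \<partial>\<alpha>) < \<infinity>"
    using k by (rule le_less_trans)
  have "(\<integral>\<^sup>+\<omega>. (emeasure (transport K \<Phi> \<omega>) B)\<^sup>2 \<partial>M) = ?V * (\<integral>\<^sup>+y. ennreal (palm_overlap Q K B y) \<partial>\<alpha>)"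
    by (rule nn_integral_palm_overlap[OF palm flow rm lsi K B])
  also have "\<dots> \<le> ?V * (\<integral>\<^sup>+y. ennreal (palm_overlap Q L B y) + ennreal \<bar>palm_overlap Q K B y - palm_overlap Q L B y\<bar> \<partial>\<alpha>)"
    using palm_overlap_nonneg[OF palm B, of L]
    by (intro mult_left_mono nn_integral_mono) (auto simp flip: ennreal_plus intro!: ennreal_leI)
  also have "\<dots> = ?V * (\<integral>\<^sup>+y. ennreal (palm_overlap Q L B y) \<partial>\<alpha>)
      + ?V * (\<integral>\<^sup>+y. ennreal \<bar>palm_overlap Q K B y - palm_overlap Q L B y\<bar> \<partial>\<alpha>)"
    by (subst nn_integral_add) (auto simp: distrib_left)
  also have "\<dots> = (\<integral>\<^sup>+\<omega>. (emeasure (transport L \<Phi> \<omega>) B)\<^sup>2 \<partial>M)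
      + ?V * (\<integral>\<^sup>+y. ennreal \<bar>palm_overlap Q K B y - palm_overlap Q L B y\<bar> \<partial>\<alpha>)"
    by (simp only: nn_integral_palm_overlap[OF palm flow rm lsi L B])
  also have "\<dots> < \<infinity>"
    using D lsi_L B by (auto simp: locally_square_integrable_def ennreal_mult_less_top less_top)
  finally show "(\<integral>\<^sup>+\<omega>. (emeasure (transport K \<Phi> \<omega>) B)\<^sup>2 \<partial>M) < \<infinity>" .
qed

lemma variance_transport:
  assumes K: "invariant_prob_kernel M \<theta> K" and lsi_K: "locally_square_integrable M (transport K \<Phi>)"
    and B: "B \<in> sets borel" "bounded B"
  shows "variance (\<lambda>\<omega>. measure (transport K \<Phi> \<omega>) B)
    = measure lborel B * (\<integral>y. palm_overlap Q K B y \<partial>\<alpha>) - (enn2real (intensity M \<Phi> * emeasure lborel B))\<^sup>2"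
    and "measure lborel B \<noteq> 0 \<Longrightarrow> integrable \<alpha> (palm_overlap Q K B)"
proof -
  have fin: "(\<integral>\<^sup>+\<omega>. (emeasure (transport K \<Phi> \<omega>) B)\<^sup>2 \<partial>M) < \<infinity>"
    using lsi_K B by (simp add: locally_square_integrable_def)
  \<comment> \<open>Both sides take the default value 0 if the integral is infinite.\<close>
  have e: "enn2real (\<integral>\<^sup>+y. ennreal (palm_overlap Q K B y) \<partial>\<alpha>) = (\<integral>y. palm_overlap Q K B y \<partial>\<alpha>)"
    using palm_overlap_nonneg[OF palm B] measurable_palm_overlap'[OF K B]
    by (subst integral_eq_nn_integral) auto
  show "variance (\<lambda>\<omega>. measure (transport K \<Phi> \<omega>) B)
    = measure lborel B * (\<integral>y. palm_overlap Q K B y \<partial>\<alpha>) - (enn2real (intensity M \<Phi> * emeasure lborel B))\<^sup>2"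
    using variance_enn2real[OF measurable_emeasure_transport[OF rm K B(1)] fin]
    by (simp add: measure_def[of "transport K \<Phi> _"] nn_integral_palm_overlap[OF palm flow rm lsi K B] e
        nn_integral_transport[OF prob_space_axioms flow rm inv K B(1)] enn2real_mult)
  assume V: "measure lborel B \<noteq> 0"
  have "(\<integral>\<^sup>+y. ennreal (palm_overlap Q K B y) \<partial>\<alpha>) < \<infinity>"
    using fin V unfolding nn_integral_palm_overlap[OF palm flow rm lsi K B]
    by (auto simp: ennreal_mult_less_top)
  then show "integrable \<alpha> (palm_overlap Q K B)"
    using palm_overlap_nonneg[OF palm B] measurable_palm_overlap'[OF K B]
    by (intro integrableI_bounded) auto
qed

lemma variance_transport_diff:
  assumes K: "invariant_prob_kernel M \<theta> K" and lsi_K: "locally_square_integrable M (transport K \<Phi>)"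
    and L: "invariant_prob_kernel M \<theta> L" and lsi_L: "locally_square_integrable M (transport L \<Phi>)"
    and B: "B \<in> sets borel" "bounded B"
  shows "ennreal \<bar>variance (\<lambda>\<omega>. measure (transport K \<Phi> \<omega>) B) / measure lborel B
      - variance (\<lambda>\<omega>. measure (transport L \<Phi> \<omega>) B) / measure lborel B\<bar>
    \<le> (\<integral>\<^sup>+y. ennreal \<bar>palm_overlap Q K B y - palm_overlap Q L B y\<bar> \<partial>\<alpha>)"
proof (cases "measure lborel B = 0")
  \<comment> \<open>The squared means are the same term in \<open>vK(1)\<close> and
    \<open>vL(1)\<close> and cancel. In the other case both quotients are 0, being divisions by
    0.\<close>
  case False
  note vK = variance_transport[OF K lsi_K B] and vL = variance_transport[OF L lsi_L B]
  have i: "integrable \<alpha> (\<lambda>y. palm_overlap Q K B y - palm_overlap Q L B y)"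
    using vK(2) vL(2) False by auto
  have "variance (\<lambda>\<omega>. measure (transport K \<Phi> \<omega>) B) / measure lborel B
      - variance (\<lambda>\<omega>. measure (transport L \<Phi> \<omega>) B) / measure lborel B
    = (\<integral>y. palm_overlap Q K B y - palm_overlap Q L B y \<partial>\<alpha>)"
    using False vK(2) vL(2) by (simp add: vK(1) vL(1) diff_divide_distrib)
  also have "\<bar>\<dots>\<bar> \<le> (\<integral>y. \<bar>palm_overlap Q K B y - palm_overlap Q L B y\<bar> \<partial>\<alpha>)"
    by (rule integral_abs_bound)
  finally show ?thesis
    using i by (subst nn_integral_eq_integral) (auto intro: ennreal_leI)
qed simp

lemma tendsto_palm_overlap:
  assumes K: "invariant_prob_kernel M \<theta> K" and W: "convex_window W" and Wm: "W \<in> sets borel"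
    and X: "filterlim X at_top sequentially"
  shows "(\<lambda>n. palm_overlap Q K (scale (X n) W) y) \<longlonglongrightarrow> 1"
proof -
  interpret P: prob_space "palm_pair Q K y" by (rule palm_pair_prob_space(1)[OF palm K])
  have B: "scale r W \<in> sets borel" "bounded (scale r W)" for r
    using W Wm by (auto simp: convex_window_def intro: bounded_scale)
  have "(\<lambda>n. \<integral>p. overlap_ratio (scale (X n) W) p \<partial>palm_pair Q K y) \<longlonglongrightarrow> (\<integral>p. 1 \<partial>palm_pair Q K y)"
  proof (rule integral_dominated_convergence[where w = "\<lambda>_. 1"])
    show "AE p in palm_pair Q K y. (\<lambda>n. overlap_ratio (scale (X n) W) p) \<longlonglongrightarrow> 1"
      using tendsto_overlap_ratio[OF W Wm X] by simp
    show "overlap_ratio (scale (X n) W) \<in> borel_measurable (palm_pair Q K y)" for n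
      using measurable_overlap_ratio[OF B(1)] palm_pair_prob_space(2)[OF palm K] by (simp cong: measurable_cong_sets)
  qed (use overlap_ratio_bounds[OF B] in auto)
  then show ?thesis by (simp add: palm_overlap_def P.prob_space)
qed

lemma tendsto_variance_transport_diff:
  assumes K: "invariant_prob_kernel M \<theta> K" and lsi_K: "locally_square_integrable M (transport K \<Phi>)"
    and L: "invariant_prob_kernel M \<theta> L" and lsi_L: "locally_square_integrable M (transport L \<Phi>)"
    and W: "convex_window W"
    and bd: "\<And>B y. B \<in> sets borel \<Longrightarrow> bounded B \<Longrightarrow> \<bar>palm_overlap Q K B y - palm_overlap Q L B y\<bar> \<le> k y"
    and k: "(\<integral>\<^sup>+y. ennreal (k y) \<partial>\<alpha>) < \<infinity>"
  shows "((\<lambda>r. variance (\<lambda>\<omega>. measure (transport K \<Phi> \<omega>) (scale r W)) / measure lebesgue (scale r W)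
      - variance (\<lambda>\<omega>. measure (transport L \<Phi> \<omega>) (scale r W)) / measure lebesgue (scale r W)) \<longlongrightarrow> 0) at_top"
    (is "(?d \<longlongrightarrow> 0) at_top")
proof (cases "W \<in> sets borel")
  case True
  have B: "scale r W \<in> sets borel" "bounded (scale r W)" for r
    using W True by (auto simp: convex_window_def intro: bounded_scale)
  show ?thesis
  proof (rule tendsto_at_topI_sequentially)
    fix X :: "nat \<Rightarrow> real" assume X: "filterlim X at_top sequentially"
    define u where "u n y = ennreal \<bar>palm_overlap Q K (scale (X n) W) y - palm_overlap Q L (scale (X n) W) y\<bar>" for n y
    have u[measurable]: "u n \<in> borel_measurable \<alpha>" for n
      unfolding u_def using measurable_palm_overlap'[OF K B] measurable_palm_overlap'[OF L B] by measurable
    have lim: "(\<lambda>n. \<integral>\<^sup>+y. u n y \<partial>\<alpha>) \<longlonglongrightarrow> (\<integral>\<^sup>+y. 0 \<partial>\<alpha>)"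
    \<comment> \<open>\<open>k\<close> need not be measurable, so the dominating function is the supremum of the \<open>u n\<close> below it.\<close>
    proof (rule nn_integral_dominated_convergence[where w = "\<lambda>y. SUP n. u n y"])
      show "AE y in \<alpha>. u n y \<le> (SUP n. u n y)" for n by (intro AE_I2 SUP_upper) simp
      have "(\<integral>\<^sup>+y. (SUP n. u n y) \<partial>\<alpha>) \<le> (\<integral>\<^sup>+y. ennreal (k y) \<partial>\<alpha>)"
        unfolding u_def using bd[OF B] by (intro nn_integral_mono SUP_least ennreal_leI)
      then show "(\<integral>\<^sup>+y. (SUP n. u n y) \<partial>\<alpha>) < \<infinity>" using k by (rule le_less_trans)
      show "AE y in \<alpha>. (\<lambda>n. u n y) \<longlonglongrightarrow> 0"
      proof (rule AE_I2)
        fix y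
        have "(\<lambda>n. \<bar>palm_overlap Q K (scale (X n) W) y - palm_overlap Q L (scale (X n) W) y\<bar>) \<longlonglongrightarrow> \<bar>1 - 1\<bar>"
          by (intro tendsto_intros tendsto_palm_overlap[OF _ W True X] K L)
        then show "(\<lambda>n. u n y) \<longlonglongrightarrow> 0"
          unfolding u_def using tendsto_ennrealI by fastforce
      qed
    qed measurable
    \<comment> \<open>The windows are Borel here, so \<open>lebesgue\<close> and
      \<open>lborel\<close> give them the same volume.\<close>
    have le: "ennreal \<bar>?d (X n)\<bar> \<le> (\<integral>\<^sup>+y. u n y \<partial>\<alpha>)" for n
      using variance_transport_diff[OF K lsi_K L lsi_L B, of "X n"] B(1)[of "X n"]
      unfolding u_def by (simp add: measure_completion)
    have "(\<lambda>n. ennreal \<bar>?d (X n)\<bar>) \<longlonglongrightarrow> 0"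
    proof (rule tendsto_sandwich[OF _ _ tendsto_const])
      show "eventually (\<lambda>n. ennreal \<bar>?d (X n)\<bar> \<le> (\<integral>\<^sup>+y. u n y \<partial>\<alpha>)) sequentially"
        using le by (intro always_eventually allI)
      show "(\<lambda>n. \<integral>\<^sup>+y. u n y \<partial>\<alpha>) \<longlonglongrightarrow> 0" using lim by simp
    qed simp
    then have "(\<lambda>n. \<bar>?d (X n)\<bar>) \<longlonglongrightarrow> 0"
      using tendsto_ennreal_iff[of "\<lambda>n. \<bar>?d (X n)\<bar>" sequentially 0] by simp
    then show "(\<lambda>n. ?d (X n)) \<longlonglongrightarrow> 0" by (rule tendsto_rabs_zero_cancel)
  qed
next
  case False
  \<comment> \<open>A bounded convex set need not be Borel; \<open>measure\<close> then takes the junk value 0 on its dilations.\<close>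
  have zero: "?d r = 0" if "r > 0" for r
  proof -
    \<comment> \<open>Rescaling by \<open>1 / r\<close> would make \<open>W\<close> itself
      Borel.\<close>
    have nb: "scale r W \<notin> sets borel"
    proof
      assume "scale r W \<in> sets borel"
      then have "scale (1 / r) (scale r W) \<in> sets borel" by (rule sets_scale)
      then show False using False that by (simp add: scale_scale_set) (simp add: scale_def)
    qed
    have "variance (\<lambda>\<omega>. measure (transport J \<Phi> \<omega>) (scale r W)) = 0" if J: "invariant_prob_kernel M \<theta> J" for J
    proof -
      have z: "measure (transport J \<Phi> \<omega>) (scale r W) = 0" if "\<omega> \<in> space M" for \<omega>
        using measure_transport_not_borel[OF rm J that nb] .
      then have "expectation (\<lambda>\<omega>. measure (transport J \<Phi> \<omega>) (scale r W)) = 0"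
        by (simp cong: Bochner_Integration.integral_cong)
      then show ?thesis using z by (simp cong: Bochner_Integration.integral_cong)
    qed
    then show ?thesis using K L by simp
  qed
  have "eventually (\<lambda>r. ?d r = 0) at_top"
    by (rule eventually_mono[OF eventually_gt_at_top[of 0]]) (rule zero)
  then show ?thesis by (rule tendsto_eventually)
qed

lemma has_asymptotic_variance_transport_transfer:
  assumes K: "invariant_prob_kernel M \<theta> K" and L: "invariant_prob_kernel M \<theta> L" and W: "convex_window W"
    and bd: "\<And>B y. B \<in> sets borel \<Longrightarrow> bounded B \<Longrightarrow> \<bar>palm_overlap Q K B y - palm_overlap Q L B y\<bar> \<le> k y"
    and k: "(\<integral>\<^sup>+y. ennreal (k y) \<partial>\<alpha>) < \<infinity>"
    and c: "has_asymptotic_variance M W (transport L \<Phi>) c"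
  shows "has_asymptotic_variance M W (transport K \<Phi>) c"
proof -
  have lsi_L: "locally_square_integrable M (transport L \<Phi>)"
    using c by (simp add: has_asymptotic_variance_def)
  have lsi_K: "locally_square_integrable M (transport K \<Phi>)"
    by (rule locally_square_integrable_transport_transfer[OF K L bd k lsi_L])
  show ?thesis
    by (rule has_asymptotic_variance_transfer[OF c lsi_K tendsto_variance_transport_diff[OF K lsi_K L lsi_L W bd k]])
qed

end

theorem theorem3p1:
  fixes M :: "'w measure"
    and \<theta> :: "'a::euclidean_space \<Rightarrow> 'w \<Rightarrow> 'w"
    and \<Phi> :: "'w \<Rightarrow> 'a measure"
    and Q :: "'a \<Rightarrow> 'w measure"
    and K L :: "'w \<Rightarrow> 'a \<Rightarrow> 'a measure"
    and W :: "'a set"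
  assumes "prob_space M"
    and "borel_space M"
    and "stationary_flow M \<theta>"
    and "random_measure M \<Phi>"
    and "invariant_measure M \<theta> \<Phi>"
    and "locally_square_integrable M \<Phi>"
    and "0 < intensity M \<Phi>" and "intensity M \<Phi> < \<infinity>"
    and "two_point_palm M \<theta> \<Phi> Q"
    and "invariant_prob_kernel M \<theta> K"
    and "invariant_prob_kernel M \<theta> L"
    and "convex_window W"
    and "(\<integral>\<^sup>+y. ennreal (kappa Q K L y) \<partial>reduced_second_moment M \<Phi>) < \<infinity>"
  shows "(\<forall>c. has_asymptotic_variance M W (transport K \<Phi>) c \<longleftrightarrow>
              has_asymptotic_variance M W (transport L \<Phi>) c) \<and>
         (hyperuniform M W (transport K \<Phi>) \<longleftrightarrow> hyperuniform M W (transport L \<Phi>))"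
proof -
  interpret palm_stationary M \<theta> \<Phi> Q
    using assms by (intro palm_stationary.intro palm_stationary_axioms.intro)
  note KL = \<open>invariant_prob_kernel M \<theta> K\<close> \<open>invariant_prob_kernel M \<theta> L\<close>
  \<comment> \<open>The absolute value is symmetric, so \<open>kappa Q K L\<close> serves for both
    directions, without swapping its arguments.\<close>
  have bd: "\<bar>palm_overlap Q K B y - palm_overlap Q L B y\<bar> \<le> kappa Q K L y"
    "\<bar>palm_overlap Q L B y - palm_overlap Q K B y\<bar> \<le> kappa Q K L y"
    if "B \<in> sets borel" "bounded B" for B y
    using palm_overlap_diff_le_kappa[OF palm KL that] by (simp_all add: abs_minus_commute)
  have "has_asymptotic_variance M W (transport K \<Phi>) c \<longleftrightarrow> has_asymptotic_variance M W (transport L \<Phi>) c" for c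
    using has_asymptotic_variance_transport_transfer[OF KL assms(12) bd(1) assms(13)]
      has_asymptotic_variance_transport_transfer[OF KL(2,1) assms(12) bd(2) assms(13)] by blast
  moreover have "stationary M (transport K \<Phi>)" "stationary M (transport L \<Phi>)"
    using stationary_transport[OF flow rm inv] KL by auto
  ultimately show ?thesis by (simp add: hyperuniform_def)
qed

end
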